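(* Let $A$, $A'$, $A_1$, $B$, $B'$, $B_1$, $B_2$, $C_1$, $C_2$, $C_1-B_1$, $C_2-B_2$ and $\mathbb{Y}$ be positive stable matrices in $\mathbb{C}^{r\times r}$ such that $A$, $A'$, $B$, $B'$, $B_1$, $B_2$, $C_1$, $C_2$ and $\mathbb{Y}$ commute with each other. Then the new extended Appell matrix function $F_2^{(A,B,A',B')}(A_1,B_1,B_2;C_1,C_2;z,w;\mathbb{Y})$ satisfies the differential formula $$\begin{aligned}\frac{d^{m+n}}{dz^m\,dw^n}&\left[F_2^{(A,B,A',B')}(A_1,B_1,B_2;C_1,C_2;z,w;\mathbb{Y})\right]\\&=(A_1)_{m+n}\left[F_2^{(A,B,A',B')}(A_1+(m+n)I,B_1+mI,B_2+nI;C_1+mI,C_2+nI;z,w;\mathbb{Y})\right]\\&\quad\times(B_1)_m(B_2)_n(C_1)^{-1}_{m+n}.\end{aligned}$$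
   Context: A matrix in $\mathbb{C}^{r\times r}$ is positive stable if all its eigenvalues have positive real part; $I$ is the identity matrix; $z,w$ are complex variables, $m,n$ are nonnegative integers, and $\frac{d^{m+n}}{dz^m\,dw^n}$ denotes differentiation $m$ times in $z$ and $n$ times in $w$. For $t>0$ and a square matrix $M$, $t^M=\exp(M\ln t)$. The Pochhammer symbol is $(M)_0=I$, $(M)_n=M(M+I)\cdots(M+(n-1)I)$ for $n\ge1$, and $(M)^{-1}_n$ is the inverse of $(M)_n$. For positive stable $B$ and a square matrix $W$, ${}_1F_1(A;B;W)=\sum_{n\ge0}(A)_n\,(B)^{-1}_n\,\frac{W^n}{n!}$. For positive stable $P,Q$ with $PQ=QP$, the beta matrix function is $\mathfrak{B}(P,Q)=\Gamma(P)\Gamma(Q)\Gamma^{-1}(P+Q)=\int_0^1t^{P-I}(1-t)^{Q-I}dt$, where $\Gamma(P)=\int_0^\infty e^{-t}t^{P-I}dt$ and $\Gamma^{-1}(P)$ is the inverse of $\Gamma(P)$. For positive stable $A,B,P,Q,\mathbb{Y}$, $$\mathfrak{B}_{\mathbb{Y}}^{(A,B)}(P,Q)=\int_0^1 {}_1F_1\!\left(A;B;-\frac{\mathbb{Y}}{t(1-t)}\right)t^{P-I}(1-t)^{Q-I}\,dt .$$ The new extended Appell matrix function $F_2^{(A,B,A',B')}$ is defined as $$\begin{aligned}F_2^{(A,B,A',B')}(A_1,B_1,B_2;C_1,C_2;z,w;\mathbb{Y})=\sum_{m,n\ge0}&(A_1)_{m+n}\,\mathfrak{B}_{\mathbb{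Y}}^{(A,B)}(B_1+mI,C_1-B_1)[\mathfrak{B}(B_1,C_1-B_1)]^{-1}\\&\times\mathfrak{B}_{\mathbb{Y}}^{(A',B')}(B_2+nI,C_2-B_2)[\mathfrak{B}(B_2,C_2-B_2)]^{-1}\frac{z^mw^n}{m!\,n!}.\end{aligned}$$
   Formalization: The printed factor (C_1)^{-1}_{m+n} is false in general (e.g. r=1, m=0, n=1, C_1=2, C_2=3) and is replaced by (C_1)^{-1}_m (C_2)^{-1}_n; z, w are taken in the domain of convergence |z|+|w|<1. *)

theory Defs
  imports "HOL-Analysis.Analysis"
begin

text \<open>
  Square complex matrices are elements of \<open>complex^'r^'r\<close>. The operations \<open>*\<close>, \<open>^\<close> and \<open>1\<close> of this
  type act componentwise, so the matrix product is \<open>**\<close>, the identity is \<open>mat 1\<close>, a scalar matrix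
  \<open>c I\<close> is \<open>mat c\<close>, and matrix powers and exponentials have to be introduced separately.
\<close>

definition positive_stable :: "complex^'r^'r \<Rightarrow> bool" where
  "positive_stable M \<longleftrightarrow> (\<forall>e v. v \<noteq> 0 \<and> M *v v = e *s v \<longrightarrow> 0 < Re e)"

primrec mpow :: "complex^'r^'r \<Rightarrow> nat \<Rightarrow> complex^'r^'r" where
  "mpow M 0 = mat 1"
| "mpow M (Suc n) = M ** mpow M n"

definition mexp :: "complex^'r^'r \<Rightarrow> complex^'r^'r" where
  "mexp M = (\<Sum>n. (1 / fact n) *\<^sub>R mpow M n)"

definition rpow :: "real \<Rightarrow> complex^'r^'r \<Rightarrow> complex^'r^'r" where
  "rpow t M = mexp (ln t *\<^sub>R M)"

primrec mpochhammer :: "complex^'r^'r \<Rightarrow> nat \<Rightarrow> complex^'r^'r" where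
  "mpochhammer M 0 = mat 1"
| "mpochhammer M (Suc n) = mpochhammer M n ** (M + mat (of_nat n))"

definition hyp1F1 :: "complex^'r^'r \<Rightarrow> complex^'r^'r \<Rightarrow> complex^'r^'r \<Rightarrow> complex^'r^'r" where
  "hyp1F1 A B W =
     (\<Sum>n. (1 / fact n) *\<^sub>R (mpochhammer A n ** matrix_inv (mpochhammer B n) ** mpow W n))"

definition mGamma :: "complex^'r^'r \<Rightarrow> complex^'r^'r" where
  "mGamma P = integral {0<..} (\<lambda>t. exp (- t) *\<^sub>R rpow t (P - mat 1))"

definition mBeta :: "complex^'r^'r \<Rightarrow> complex^'r^'r \<Rightarrow> complex^'r^'r" where
  "mBeta P Q = mGamma P ** mGamma Q ** matrix_inv (mGamma (P + Q))"

definition ext_mBeta ::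
  "complex^'r^'r \<Rightarrow> complex^'r^'r \<Rightarrow> complex^'r^'r \<Rightarrow> complex^'r^'r \<Rightarrow> complex^'r^'r \<Rightarrow> complex^'r^'r" where
  "ext_mBeta A B Y P Q =
     integral {0<..<1} (\<lambda>t. hyp1F1 A B (- ((1 / (t * (1 - t))) *\<^sub>R Y))
                              ** rpow t (P - mat 1) ** rpow (1 - t) (Q - mat 1))"

text \<open>
  The double series is the unordered sum over all pairs, which is how it is used on its domain of
  (absolute) convergence \<open>cmod z + cmod w < 1\<close>.
\<close>

definition ext_F2 ::
  "complex^'r^'r \<Rightarrow> complex^'r^'r \<Rightarrow> complex^'r^'r \<Rightarrow> complex^'r^'r \<Rightarrow>
   complex^'r^'r \<Rightarrow> complex^'r^'r \<Rightarrow> complex^'r^'r \<Rightarrow> complex^'r^'r \<Rightarrow> complex^'r^'r \<Rightarrow>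
   complex \<Rightarrow> complex \<Rightarrow> complex^'r^'r \<Rightarrow> complex^'r^'r" where
  "ext_F2 A B A' B' A1 B1 B2 C1 C2 z w Y =
     (\<Sum>\<^sub>\<infinity>(m, n)\<in>UNIV.
        mpochhammer A1 (m + n)
        ** ext_mBeta A B Y (B1 + mat (of_nat m)) (C1 - B1) ** matrix_inv (mBeta B1 (C1 - B1))
        ** ext_mBeta A' B' Y (B2 + mat (of_nat n)) (C2 - B2) ** matrix_inv (mBeta B2 (C2 - B2))
        ** mat (z ^ m * w ^ n / (fact m * fact n)))"

text \<open>
  Complex derivatives of matrix-valued functions, as relations, so that existence of the
  derivatives is part of the claim. The Frechet derivative is required to be \<open>h \<mapsto> h D\<close>, i.e. \<open>D\<close> is
  the entrywise complex derivative. In \<open>has_mixed_derivative m n F D z w\<close> the function is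
  differentiated first \<open>n\<close> times in its second and then \<open>m\<close> times in its first argument.
\<close>

primrec has_nth_derivative ::
  "nat \<Rightarrow> (complex \<Rightarrow> complex^'r^'r) \<Rightarrow> complex^'r^'r \<Rightarrow> complex \<Rightarrow> bool" where
  "has_nth_derivative 0 f D z \<longleftrightarrow> f z = D"
| "has_nth_derivative (Suc k) f D z \<longleftrightarrow>
     (\<exists>g. (\<forall>\<^sub>F u in nhds z. (f has_derivative (\<lambda>h. mat h ** g u)) (at u)) \<and>
          has_nth_derivative k g D z)"

definition has_mixed_derivative ::
  "nat \<Rightarrow> nat \<Rightarrow> (complex \<Rightarrow> complex \<Rightarrow> complex^'r^'r) \<Rightarrow> complex^'r^'r \<Rightarrow> complex \<Rightarrow> complex \<Rightarrow> bool" where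
  "has_mixed_derivative m n F D z w \<longleftrightarrow>
     (\<exists>G. (\<forall>\<^sub>F u in nhds z. has_nth_derivative n (\<lambda>v. F u v) (G u) w) \<and>
          has_nth_derivative m G D z)"

end

theory Submission
  imports Defs "HOL-Computational_Algebra.Fundamental_Theorem_Algebra" "HOL-Real_Asymp.Real_Asymp"
begin

text \<open>
  Differentiating the double series termwise shifts the summation indices. The shifted series is
  again an Appell series because \<open>(A\<^sub>1)\<^sub>k\<^sub>+\<^sub>j = (A\<^sub>1)\<^sub>k (A\<^sub>1 + kI)\<^sub>j\<close> and
  \<open>\<Gamma>(P + kI) = (P)\<^sub>k \<Gamma>(P)\<close>, which needs that \<open>\<Gamma>(P)\<close> is invertible: its kernel would contain an
  eigenvector of \<open>P\<close>, on which \<open>\<Gamma>(P)\<close> acts as a nonzero scalar Gamma value.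
  Absolute convergence for \<open>\<bar>z\<bar> + \<bar>w\<bar> < 1\<close> only requires that the extended beta values at \<open>P + mI\<close>
  are bounded in \<open>m\<close>, and this follows from the second mean value theorem for integrals, without
  any asymptotics of \<open>\<^sub>1F\<^sub>1\<close>.
\<close>

section \<open>Matrix algebra and analysis\<close>

text \<open>The extended beta values pass through unchanged: shifting \<open>B1\<close> and
  \<open>C1\<close> together leaves \<open>C1 - B1\<close> fixed, so the shifted series contains
  literally the same values at index \<open>p + m\<close>, and only the Gamma quotient in
  \<open>mBeta\<close> has to be computed. A divergent extended beta integral has the default value
  0, which respects boundedness and commutation alike. The obstacle is spectral: positive stability
  speaks of eigenvalues only, while the Gamma integral needs a norm bound on t^P near 0. Both this
  bound and the eigenvector in the kernel come from one fact, in the role of the Jordan form: some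
  product of factors P - lI over eigenvalues l of P is 0. Integrating a linear differential equation
  once per factor yields the bound. \<open>A1\<close> is not among the commuting matrices, so its
  Pochhammer factors stay leftmost throughout.\<close>

lemma bounded_bilinear_matrix_matrix_mult:
  "bounded_bilinear ((**) :: complex^'n^'m \<Rightarrow> complex^'p^'n \<Rightarrow> complex^'p^'m)"
proof -
  have "bilinear ((**) :: complex^'n^'m \<Rightarrow> complex^'p^'n \<Rightarrow> complex^'p^'m)"
    unfolding bilinear_def
    by (intro conjI allI linearI)
       (simp_all add: vec_eq_iff matrix_matrix_mult_def sum.distrib scaleR_sum_right algebra_simps)
  then show ?thesis by (simp add: bilinear_conv_bounded_bilinear)
qed

lemma bounded_bilinear_matrix_vector_mult:
  "bounded_bilinear ((*v) :: complex^'n^'m \<Rightarrow> complex^'n \<Rightarrow> complex^'m)"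
proof -
  have "bilinear ((*v) :: complex^'n^'m \<Rightarrow> complex^'n \<Rightarrow> complex^'m)"
    unfolding bilinear_def
    by (intro conjI allI linearI)
       (simp_all add: vec_eq_iff matrix_vector_mult_def sum.distrib scaleR_sum_right algebra_simps)
  then show ?thesis by (simp add: bilinear_conv_bounded_bilinear)
qed

text \<open>The type's own \<open>*\<close> is componentwise, so distributivity, series, derivatives
  and integrals for the matrix product are all drawn from this interpretation.\<close>

interpretation mm: bounded_bilinear "(**) :: complex^'n^'n \<Rightarrow> complex^'n^'n \<Rightarrow> complex^'n^'n"
  by (rule bounded_bilinear_matrix_matrix_mult)

interpretation mv: bounded_bilinear "(*v) :: complex^'n^'n \<Rightarrow> complex^'n \<Rightarrow> complex^'n"
  by (rule bounded_bilinear_matrix_vector_mult)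

section \<open>Scalar matrices\<close>

lemma mat_mult_nth: "(mat c ** M) $ i $ j = c * (M :: complex^'n^'n) $ i $ j"
  by (simp add: matrix_matrix_mult_def mat_def if_distrib[of "\<lambda>x. x * _"] cong: if_cong)

lemma mult_mat_nth: "(M ** mat c) $ i $ j = (M :: complex^'n^'n) $ i $ j * c"
  by (simp add: matrix_matrix_mult_def mat_def if_distrib[of "\<lambda>x. _ * x"] cong: if_cong)

lemma mat_commute: "M ** mat c = mat c ** (M :: complex^'n^'n)"
  by (simp add: vec_eq_iff mat_mult_nth mult_mat_nth)

lemma mat_mult_mat: "mat a ** mat b = (mat (a * b) :: complex^'n^'n)"
  by (simp add: vec_eq_iff mat_mult_nth) (simp add: mat_def)

lemma mat_mult_vector: "mat c *v v = c *s (v :: complex^'n)"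
  by (simp add: vec_eq_iff matrix_vector_mult_def mat_def if_distrib[of "\<lambda>x. x * _"] cong: if_cong)

lemma mat_of_real_mult: "mat (of_real c) ** M = c *\<^sub>R (M :: complex^'n^'n)"
  by (simp add: vec_eq_iff mat_mult_nth scaleR_conv_of_real[where 'a = complex])

lemma mat_of_nat_mult: "mat (of_nat k) ** M = real k *\<^sub>R (M :: complex^'n^'n)"
  using mat_of_real_mult[of "real k" M] by simp

lemma mat_diff: "mat a - mat b = (mat (a - b) :: complex^'n^'n)"
  by (simp add: vec_eq_iff mat_def)

lemma mat_add: "mat a + mat b = (mat (a + b) :: complex^'n^'n)"
  by (simp add: vec_eq_iff mat_def)

lemma norm_mat_mult: "norm (mat c ** M) = cmod c * norm (M :: complex^'n^'n)"
  by (simp add: norm_vec_def L2_set_def mat_mult_nth norm_mult power_mult_distrib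
      sum_nonneg flip: sum_distrib_left) (simp add: real_sqrt_mult)

lemma bounded_linear_axis: "bounded_linear (axis i :: 'a::real_normed_vector \<Rightarrow> 'a^'n)"
  by (rule bounded_linear_intro[where K = 1])
     (auto simp: vec_eq_iff axis_def norm_vec_def L2_set_def if_distrib[of "\<lambda>x. norm x ^ 2"] cong: if_cong)

text \<open>A vector is the sum of its components placed on the axes, so componentwise derivatives
  add up. Applied twice, it reduces matrix-valued claims to scalar power series.\<close>

lemma has_derivative_vecI:
  fixes f :: "'a::real_normed_vector \<Rightarrow> 'b::real_normed_vector^'n"
  assumes "\<And>i. ((\<lambda>x. f x $ i) has_derivative (\<lambda>h. f' h $ i)) F"
  shows "(f has_derivative f') F"
proof -
  have *: "g = (\<lambda>x. \<Sum>i\<in>UNIV. axis i (g x $ i))" for g :: "'c \<Rightarrow> 'b^'n"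
    by (auto simp: fun_eq_iff vec_eq_iff axis_def)
  have "((\<lambda>x. \<Sum>i\<in>UNIV. axis i (f x $ i)) has_derivative (\<lambda>h. \<Sum>i\<in>UNIV. axis i (f' h $ i))) F"
    by (intro has_derivative_sum bounded_linear.has_derivative[OF bounded_linear_axis] assms)
  then show ?thesis by (simp flip: *)
qed

lemma bounded_linear_nth_nth: "bounded_linear (\<lambda>M :: complex^'n^'m. M $ i $ j)"
  by (intro bounded_linear_compose[OF bounded_linear_vec_nth] bounded_linear_vec_nth)

section \<open>Inverses and commutation\<close>

lemma matrix_inv_unique:
  fixes M N :: "complex^'n^'n"
  assumes "M ** N = mat 1" "N ** M = mat 1"
  shows "matrix_inv M = N"
proof -
  have "M ** matrix_inv M = mat 1 \<and> matrix_inv M ** M = mat 1"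
    unfolding matrix_inv_def by (rule someI[of _ N]) (use assms in simp)
  then show ?thesis
    by (metis assms(2) matrix_mul_assoc matrix_mul_lid matrix_mul_rid)
qed

lemma matrix_inv_inverse:
  fixes M :: "complex^'n^'n"
  assumes "invertible M"
  shows "M ** matrix_inv M = mat 1" "matrix_inv M ** M = mat 1"
  using assms matrix_inv_unique unfolding invertible_def by metis+

lemma matrix_inv_mult:
  fixes M N :: "complex^'n^'n"
  assumes "invertible M" "invertible N"
  shows "matrix_inv (M ** N) = matrix_inv N ** matrix_inv M"
  by (rule matrix_inv_unique)
     (metis assms matrix_inv_inverse matrix_mul_assoc matrix_mul_rid)+

lemma invertible_matrix_inv:
  fixes M :: "complex^'n^'n"
  assumes "invertible M"
  shows "invertible (matrix_inv M)"
  using assms matrix_inv_inverse unfolding invertible_def by metis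

lemma matrix_inv_matrix_inv:
  fixes M :: "complex^'n^'n"
  assumes "invertible M"
  shows "matrix_inv (matrix_inv M) = M"
  using assms by (intro matrix_inv_unique matrix_inv_inverse)

lemma matrix_inv_commute:
  fixes M N :: "complex^'n^'n"
  assumes "invertible M" "M ** N = N ** M"
  shows "matrix_inv M ** N = N ** matrix_inv M"
  by (metis assms matrix_inv_inverse matrix_mul_assoc matrix_mul_lid matrix_mul_rid)

lemma matrix_mult_commute:
  fixes X M N :: "complex^'n^'n"
  assumes "X ** M = M ** X" "X ** N = N ** X"
  shows "X ** (M ** N) = M ** N ** X"
  by (metis assms matrix_mul_assoc)

lemma commute_add_mat:
  fixes X M :: "complex^'n^'n"
  assumes "X ** M = M ** X"
  shows "X ** (M + mat c) = (M + mat c) ** X"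
  using assms by (simp add: mm.add_left mm.add_right mat_commute)

lemma commute_mpow:
  fixes X M :: "complex^'n^'n"
  assumes "X ** M = M ** X"
  shows "X ** mpow M n = mpow M n ** X"
  by (induction n) (auto intro: matrix_mult_commute assms)

lemma commute_mpochhammer:
  fixes X M :: "complex^'n^'n"
  assumes "X ** M = M ** X"
  shows "X ** mpochhammer M n = mpochhammer M n ** X"
  by (induction n) (auto intro: matrix_mult_commute commute_add_mat assms)

section \<open>Invertibility from positive stability\<close>

lemma invertible_if_kernel_trivial:
  fixes M :: "complex^'n^'n"
  assumes "\<And>v. M *v v = 0 \<Longrightarrow> v = 0"
  shows "invertible M"
  using assms by (metis invertible_left_inverse matrix_left_invertible_ker)

lemma positive_stable_add_nat:
  assumes "positive_stable P"
  shows "positive_stable (P + mat (of_nat k))"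
  unfolding positive_stable_def
proof safe
  fix e v assume "v \<noteq> 0" "(P + mat (of_nat k)) *v v = e *s v"
  then have "P *v v = (e - of_nat k) *s v"
    by (simp add: matrix_vector_mult_add_rdistrib mat_mult_vector eq_diff_eq
        vec.scale_left_diff_distrib)
  with assms \<open>v \<noteq> 0\<close> have "0 < Re (e - of_nat k)" unfolding positive_stable_def by blast
  then show "0 < Re e" by simp
qed

lemma positive_stable_invertible:
  assumes "positive_stable P"
  shows "invertible P"
proof (rule invertible_if_kernel_trivial)
  fix v assume "P *v v = 0"
  then have "P *v v = 0 *s v" by simp
  with assms show "v = 0" by (force simp: positive_stable_def)
qed

lemma invertible_mpochhammer:
  assumes "positive_stable P"
  shows "invertible (mpochhammer P n)"
proof (induction n)
  case 0
  show ?case by (auto simp: invertible_def intro: exI[of _ "mat 1"])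
next
  case (Suc n)
  then show ?case
    using assms by (auto intro: invertible_mult positive_stable_invertible positive_stable_add_nat)
qed

lemma mpochhammer_add:
  "mpochhammer M (k + n) = mpochhammer M k ** mpochhammer (M + mat (of_nat k)) n"
  by (induction n) (simp_all add: matrix_mul_assoc mat_add add.assoc)

section \<open>The matrix exponential\<close>

lemma norm_matrix_mult_le:
  "\<exists>K\<ge>0. \<forall>(M::complex^'n^'n) (N::complex^'n^'n). norm (M ** N) \<le> K * norm M * norm N"
  using mm.nonneg_bounded by (simp add: mult_ac)

text \<open>The norm of nested vectors is the Frobenius norm, in which the identity need not have
  norm 1; hence the factor \<open>norm (mat 1)\<close>. \<open>K\<close> is the constant of bilinear
  boundedness.\<close>

lemma norm_mpow_le:
  shows "\<exists>K\<ge>0. \<forall>M::complex^'n^'n. \<forall>n. norm (mpow M n) \<le> (K * norm M) ^ n * norm (mat 1 :: complex^'n^'n)"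
proof -
  obtain K where K: "K \<ge> 0" "\<And>(M::complex^'n^'n) (N::complex^'n^'n). norm (M ** N) \<le> K * norm M * norm N"
    using norm_matrix_mult_le by blast
  have "norm (mpow M n) \<le> (K * norm M) ^ n * norm (mat 1 :: complex^'n^'n)" for M :: "complex^'n^'n" and n
  proof (induction n)
    case (Suc n)
    have "norm (mpow M (Suc n)) \<le> (K * norm M) * norm (mpow M n)"
      using K(2)[of M "mpow M n"] by (simp add: mult_ac)
    also have "\<dots> \<le> (K * norm M) * ((K * norm M) ^ n * norm (mat 1 :: complex^'n^'n))"
      using K(1) by (intro mult_left_mono Suc) auto
    finally show ?case by (simp add: mult_ac)
  qed simp
  with K(1) show ?thesis by blast
qed

lemma mexp_sums: "\<And>M::complex^'n^'n. (\<lambda>n. (1 / fact n) *\<^sub>R mpow M n) sums mexp M"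
  and norm_mexp_le:
    "\<exists>K\<ge>0. \<forall>M::complex^'n^'n. norm (mexp M) \<le> exp (K * norm M) * norm (mat 1 :: complex^'n^'n)"
proof -
  obtain K where K: "K \<ge> 0" 
    "\<And>(M::complex^'n^'n) n. norm (mpow M n) \<le> (K * norm M) ^ n * norm (mat 1 :: complex^'n^'n)"
    using norm_mpow_le by blast
  define N where "N = norm (mat 1 :: complex^'n^'n)"
  have E: "(\<lambda>n. (K * norm M) ^ n / fact n * N) sums (exp (K * norm M) * N)" for M :: "complex^'n^'n"
    using sums_mult2[OF exp_converges[of "K * norm M"], of N] by (simp add: field_simps)
  have le: "norm ((1 / fact n) *\<^sub>R mpow M n) \<le> (K * norm M) ^ n / fact n * N" for M :: "complex^'n^'n" and n
    using K(2)[of M n] by (simp add: N_def field_simps)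
  have s: "summable (\<lambda>n. norm ((1 / fact n) *\<^sub>R mpow M n))" for M :: "complex^'n^'n"
    by (rule summable_comparison_test'[OF sums_summable[OF E[of M]], where N = 0]) (use le in auto)
  have "norm (mexp M) \<le> exp (K * norm M) * N" for M :: "complex^'n^'n"
  proof -
    have "norm (mexp M) \<le> (\<Sum>n. norm ((1 / fact n) *\<^sub>R mpow M n))"
      unfolding mexp_def by (rule summable_norm[OF s])
    also have "\<dots> \<le> (\<Sum>n. (K * norm M) ^ n / fact n * N)"
      by (rule suminf_le[OF le s sums_summable[OF E]])
    finally show ?thesis using sums_unique[OF E[of M]] by simp
  qed
  with K(1) show "\<exists>K\<ge>0. \<forall>M::complex^'n^'n. norm (mexp M) \<le> exp (K * norm M) * norm (mat 1 :: complex^'n^'n)"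
    unfolding N_def by blast
  show "(\<lambda>n. (1 / fact n) *\<^sub>R mpow M n) sums mexp M" for M :: "complex^'n^'n"
    unfolding mexp_def by (rule summable_sums[OF summable_norm_cancel[OF s]])
qed

lemma commute_mexp:
  assumes "X ** M = M ** X"
  shows "X ** mexp M = mexp M ** X"
proof -
  have "(\<lambda>n. X ** ((1 / fact n) *\<^sub>R mpow M n)) sums (X ** mexp M)"
    by (rule bounded_linear.sums[OF mm.bounded_linear_right mexp_sums])
  moreover have "(\<lambda>n. ((1 / fact n) *\<^sub>R mpow M n) ** X) sums (mexp M ** X)"
    by (rule bounded_linear.sums[OF mm.bounded_linear_left mexp_sums])
  moreover have "X ** ((1 / fact n) *\<^sub>R mpow M n) = ((1 / fact n) *\<^sub>R mpow M n) ** X" for n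
    using commute_mpow[OF assms] by (simp add: mm.scaleR_left mm.scaleR_right)
  ultimately show ?thesis by (simp add: sums_unique2)
qed

lemma mpow_scaleR: "mpow (s *\<^sub>R M) n = s ^ n *\<^sub>R mpow M n"
  by (induction n) (simp_all add: mm.scaleR_left mm.scaleR_right mult_ac)

lemma mexp_zero: "mexp (0 :: complex^'n^'n) = mat 1"
proof -
  have "mpow (0 :: complex^'n^'n) n = (if n = 0 then mat 1 else 0)" for n by (cases n) (simp_all add: mm.zero_left)
  then have "(\<lambda>n. (1 / fact n) *\<^sub>R mpow (0 :: complex^'n^'n) n) = (\<lambda>n. if n = 0 then mat 1 else 0)"
    by auto
  then have "(\<lambda>n. if n = 0 then mat 1 else 0) sums mexp (0 :: complex^'n^'n)"
    using mexp_sums[of "0 :: complex^'n^'n"] by simp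
  moreover have "(\<lambda>n. if n = 0 then mat 1 else 0) sums (mat 1 :: complex^'n^'n)"
    by (rule sums_single[of 0 "\<lambda>_. mat 1"])
  ultimately show ?thesis by (rule sums_unique2)
qed

text \<open>Each entry is an everywhere convergent scalar power series in s, which may be
  differentiated termwise.\<close>

lemma mexp_scaleR_has_vector_derivative:
  fixes P :: "complex^'n^'n"
  shows "((\<lambda>s. mexp (s *\<^sub>R P)) has_vector_derivative P ** mexp (s *\<^sub>R P)) (at s)"
  unfolding has_vector_derivative_def
proof (rule has_derivative_vecI, rule has_derivative_vecI)
  fix i j
  define c where "c n = mpow P n $ i $ j / fact n" for n
  obtain K where K: "K \<ge> 0" 
    "\<And>(M::complex^'n^'n) n. norm (mpow M n) \<le> (K * norm M) ^ n * norm (mat 1 :: complex^'n^'n)"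
    using norm_mpow_le by blast
  have sm: "summable (\<lambda>n. c n * y ^ n)" for y
  proof (rule summable_comparison_test')
    show "summable (\<lambda>n. inverse (fact n) * (K * norm P * cmod y) ^ n * norm (mat 1 :: complex^'n^'n))"
      by (intro summable_mult2 summable_exp)
    fix n :: nat
    have "cmod (mpow P n $ i $ j) \<le> norm (mpow P n)"
      by (rule order_trans[OF Finite_Cartesian_Product.norm_nth_le Finite_Cartesian_Product.norm_nth_le])
    also note K(2)[of P n]
    finally have "cmod (mpow P n $ i $ j) * cmod y ^ n / fact n \<le>
        (K * norm P) ^ n * norm (mat 1 :: complex^'n^'n) * cmod y ^ n / fact n"
      by (intro divide_right_mono mult_right_mono) auto
    then show "norm (c n * y ^ n) \<le> inverse (fact n) * (K * norm P * cmod y) ^ n * norm (mat 1 :: complex^'n^'n)"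
      by (simp add: c_def norm_mult norm_divide norm_power field_simps)
  qed
  have ser: "mexp (t *\<^sub>R P) $ i $ j = (\<Sum>n. c n * of_real t ^ n)" for t
    using bounded_linear.sums[OF bounded_linear_nth_nth mexp_sums[of "t *\<^sub>R P"], of i j]
    by (intro sums_unique)
       (simp add: c_def mpow_scaleR scaleR_conv_of_real[where 'a = complex] field_simps)
  \<comment> \<open>The factor n + 1 from differentiation cancels against (n + 1)!, leaving one
    extra factor \<open>P\<close>.\<close>
  have diffs: "diffs c n = (P ** mpow P n) $ i $ j / fact n" for n
    by (simp add: diffs_def c_def del: of_nat_Suc)
  have ser': "(P ** mexp (t *\<^sub>R P)) $ i $ j = (\<Sum>n. diffs c n * of_real t ^ n)" for t
    using bounded_linear.sums[OF bounded_linear_nth_nth bounded_linear.sums[OF mm.bounded_linear_right[of P] mexp_sums[of "t *\<^sub>R P"]], of i j]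
    by (intro sums_unique)
       (simp add: diffs mpow_scaleR mm.scaleR_right scaleR_conv_of_real[where 'a = complex] field_simps)
  have "((\<lambda>t. \<Sum>n. c n * of_real t ^ n) has_vector_derivative (\<Sum>n. diffs c n * of_real s ^ n)) (at s)"
    by (rule has_vector_derivative_real_field) (rule termdiffs_strong_converges_everywhere[OF sm])
  then show "((\<lambda>x. mexp (x *\<^sub>R P) $ i $ j) has_derivative
              (\<lambda>h. (h *\<^sub>R (P ** mexp (s *\<^sub>R P))) $ i $ j)) (at s)"
    by (simp add: ser ser' has_vector_derivative_def)
qed

text \<open>Once the scalar exponential is divided out, both sides solve f' = P f with the same
  initial value. Exponents are only ever shifted by scalar matrices, so this addition law
  suffices.\<close>

lemma mexp_add_mat:
  fixes P :: "complex^'n^'n"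
  shows "mexp (s *\<^sub>R (P + mat (of_real c))) = exp (s * c) *\<^sub>R mexp (s *\<^sub>R P)"
proof -
  \<comment> \<open>Uniqueness for f' = P f: the product exp(-sP) f(s) has derivative 0.\<close>
  have key: "mexp (- (s *\<^sub>R P)) ** f s = f 0"
    if f: "\<And>s. (f has_vector_derivative P ** f s) (at s)" for f :: "real \<Rightarrow> complex^'n^'n" and s and P :: "complex^'n^'n"
  proof -
    have "((\<lambda>t. mexp ((- t) *\<^sub>R P) ** f t) has_vector_derivative 0) (at t)" for t
    proof -
      have "((\<lambda>t. mexp ((- t) *\<^sub>R P)) has_vector_derivative (- 1) *\<^sub>R (P ** mexp ((- t) *\<^sub>R P))) (at t)"
        by (rule vector_diff_chain_at[of uminus "- 1" t "\<lambda>s. mexp (s *\<^sub>R P)", unfolded o_def])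
           (auto intro!: derivative_eq_intros mexp_scaleR_has_vector_derivative[of P "- t", simplified])
      from mm.has_vector_derivative[OF this f[of t]]
      have "((\<lambda>t. mexp ((- t) *\<^sub>R P) ** f t) has_vector_derivative
         mexp ((- t) *\<^sub>R P) ** (P ** f t) + ((- 1) *\<^sub>R (P ** mexp ((- t) *\<^sub>R P))) ** f t) (at t)" .
      moreover have "P ** mexp ((- t) *\<^sub>R P) = mexp ((- t) *\<^sub>R P) ** P"
        by (rule commute_mexp) (simp add: mm.minus_left mm.minus_right mm.scaleR_left mm.scaleR_right)
      ultimately show ?thesis
        by (simp add: mm.minus_left matrix_mul_assoc)
    qed
    then obtain C where "\<And>t. mexp ((- t) *\<^sub>R P) ** f t = C"
      using has_vector_derivative_zero_constant[of UNIV] by auto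
    from this[of s] this[of 0] show ?thesis by (simp add: mexp_zero)
  qed
  have inv: "mexp (- (s *\<^sub>R P)) ** mexp (s *\<^sub>R P) = mat 1" for s and P :: "complex^'n^'n"
    using key[where f = "\<lambda>s. mexp (s *\<^sub>R P)", OF mexp_scaleR_has_vector_derivative]
    by (simp add: mexp_zero)
  show "mexp (s *\<^sub>R (P + mat (of_real c))) = exp (s * c) *\<^sub>R mexp (s *\<^sub>R P)"
  proof -
    let ?Q = "P + mat (of_real c)"
    let ?f = "\<lambda>s. exp (- (s * c)) *\<^sub>R mexp (s *\<^sub>R ?Q)"
    have "(?f has_vector_derivative P ** ?f t) (at t)" for t
    proof -
      have "(?f has_vector_derivative
          exp (- (t * c)) *\<^sub>R (?Q ** mexp (t *\<^sub>R ?Q)) + (- c * exp (- (t * c))) *\<^sub>R mexp (t *\<^sub>R ?Q)) (at t)"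
        by (rule bounded_bilinear.has_vector_derivative[OF bounded_bilinear_scaleR _ mexp_scaleR_has_vector_derivative])
           (auto intro!: derivative_eq_intros simp flip: has_real_derivative_iff_has_vector_derivative)
      then show ?thesis
        by (simp add: mm.add_left mat_of_real_mult mm.scaleR_right algebra_simps)
    qed
    then have "mexp (- (s *\<^sub>R P)) ** ?f s = mat 1"
      using key[where f = ?f] by (simp add: mexp_zero)
    then have "mexp (- (- s *\<^sub>R P)) ** (mexp (- s *\<^sub>R P) ** ?f s) = mexp (s *\<^sub>R P)"
      by simp
    then have "?f s = mexp (s *\<^sub>R P)"
      using inv[of "- s" P] by (simp only: matrix_mul_assoc matrix_mul_lid)
    moreover have "mexp (s *\<^sub>R ?Q) = exp (s * c) *\<^sub>R ?f s" by (simp add: exp_minus)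
    ultimately show ?thesis by simp
  qed
qed

section \<open>Annihilating polynomials and decay\<close>

text \<open>There are more powers than the real dimension of the matrix space, which is also why
  real coefficients suffice.\<close>

lemma matrix_linear_dependence:
  fixes P :: "complex^'n^'n"
  obtains c :: "nat \<Rightarrow> real" and N k where "k \<le> N" "c k \<noteq> 0" "(\<Sum>i\<le>N. c i *\<^sub>R mpow P i) = 0"
proof -
  define N where "N = DIM(complex^'n^'n)"
  show ?thesis
  \<comment> \<open>Dependence is a property of sets: a repeated power would shrink the set of
    powers, but is itself a relation.\<close>
  proof (cases "inj_on (mpow P) {..N}")
    case False
    then obtain i j where ij: "i \<le> N" "j \<le> N" "i \<noteq> j" "mpow P i = mpow P j"
      by (auto simp: inj_on_def)
    define c :: "nat \<Rightarrow> real" where "c n = (if n = i then 1 else if n = j then - 1 else 0)" for n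
    have "(\<Sum>n\<le>N. c n *\<^sub>R mpow P n) = (\<Sum>n\<in>{i, j}. c n *\<^sub>R mpow P n)"
      by (rule sum.mono_neutral_right) (use ij in \<open>auto simp: c_def\<close>)
    also have "\<dots> = 0" using ij by (simp add: c_def)
    finally show ?thesis using that[of i N c] ij by (simp add: c_def)
  next
    case True
    then have "card (mpow P ` {..N}) = Suc N" by (simp add: card_image)
    then have "dependent (mpow P ` {..N})"
      by (intro dependent_biggerset) (auto simp: N_def)
    then obtain u where u: "\<exists>v\<in>mpow P ` {..N}. u v \<noteq> 0" "(\<Sum>v\<in>mpow P ` {..N}. u v *\<^sub>R v) = 0"
      by (auto simp: dependent_finite)
    have "(\<Sum>i\<le>N. u (mpow P i) *\<^sub>R mpow P i) = 0"
      using u(2) by (simp add: sum.reindex[OF True])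
    with u(1) show ?thesis using that[of _ N "\<lambda>i. u (mpow P i)"] by auto
  qed
qed

definition poly_mat :: "complex poly \<Rightarrow> complex^'n^'n \<Rightarrow> complex^'n^'n" where
  "poly_mat p P = (\<Sum>i\<le>degree p. mat (coeff p i) ** mpow P i)"

lemma poly_mat_altdef:
  assumes "degree p \<le> N"
  shows "poly_mat p P = (\<Sum>i\<le>N. mat (coeff p i) ** mpow P i)"
  unfolding poly_mat_def using assms
  by (intro sum.mono_neutral_left) (auto simp: coeff_eq_0 mat_def vec_eq_iff matrix_matrix_mult_def)

lemma poly_mat_linear_factor:
  "poly_mat ([:- l, 1:] * q) P = poly_mat q P ** (P - mat l)"
proof -
  let ?N = "Suc (degree q)"
  have "degree ([:- l, 1:] * q) \<le> ?N"
    using degree_mult_le[of "[:- l, 1:]" q] by simp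
  then have "poly_mat ([:- l, 1:] * q) P =
      (\<Sum>i\<le>?N. mat (coeff (pCons 0 q) i) ** mpow P i) - (\<Sum>i\<le>?N. mat l ** (mat (coeff q i) ** mpow P i))"
    by (subst poly_mat_altdef[of _ ?N])
       (simp_all add: matrix_mul_assoc mat_mult_mat flip: sum_subtractf mm.diff_left mat_diff del: sum.atMost_Suc)
  also have "(\<Sum>i\<le>?N. mat l ** (mat (coeff q i) ** mpow P i)) = poly_mat q P ** mat l"
    by (subst poly_mat_altdef[of _ ?N]) (simp_all add: mat_commute mm.sum_right del: sum.atMost_Suc)
  also have "(\<Sum>i\<le>?N. mat (coeff (pCons 0 q) i) ** mpow P i) = poly_mat q P ** P"
    unfolding poly_mat_def sum.atMost_Suc_shift
    by (simp add: mm.sum_left commute_mpow[of P P] flip: matrix_mul_assoc)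
  finally show ?thesis by (simp add: mm.diff_right)
qed

text \<open>The fold is the product of the factors \<open>P - mat l\<close> over \<open>ls\<close>
  applied to \<open>V\<close>, the head of the list acting first. With \<open>V\<close> as
  accumulator, inductions over \<open>ls\<close> can replace \<open>V\<close> by
  \<open>(P - mat l) ** V\<close>.\<close>

lemma foldl_factors_commute:
  fixes P X V :: "complex^'n^'n"
  assumes "X ** P = P ** X"
  shows "foldl (\<lambda>V l. (P - mat l) ** V) (X ** V) ls = X ** foldl (\<lambda>V l. (P - mat l) ** V) V ls"
proof (induction ls arbitrary: V)
  case (Cons l ls)
  have "(P - mat l) ** (X ** V) = X ** ((P - mat l) ** V)"
    using assms by (simp add: matrix_mul_assoc mm.diff_left mm.diff_right mat_commute)
  then show ?case using Cons by simp
qed simp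

lemma foldl_factors_mult:
  fixes P V W :: "complex^'n^'n"
  shows
  "foldl (\<lambda>V l. (P - mat l) ** V) (V ** W) ls = foldl (\<lambda>V l. (P - mat l) ** V) V ls ** W"
  by (induction ls arbitrary: V) (simp_all add: matrix_mul_assoc)

text \<open>A nonzero annihilating polynomial splits into linear factors over the complex numbers. A
  factor whose root is no eigenvalue is invertible and can be cancelled, so only eigenvalues remain,
  possibly repeated.\<close>

lemma eigenvalue_factorisation:
  fixes P :: "complex^'n^'n"
  shows "\<exists>ls. (\<forall>l\<in>set ls. \<exists>v. v \<noteq> 0 \<and> P *v v = l *s v) \<and>
    (\<forall>V :: complex^'n^'n. foldl (\<lambda>V l. (P - mat l) ** V) V ls = 0)"
proof -
  \<comment> \<open>\<open>V\<close> is general so that a split-off factor can be absorbed into it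
    while the degree drops.\<close>
  have *: "\<exists>ls. (\<forall>l\<in>set ls. \<exists>v. v \<noteq> 0 \<and> P *v v = l *s v) \<and> foldl (\<lambda>V l. (P - mat l) ** V) V ls = 0"
    if "p \<noteq> 0" "poly_mat p P ** V = 0" for p and V :: "complex^'n^'n"
    using that
  proof (induction "degree p" arbitrary: p V)
    case 0
    obtain a where p: "p = [:a:]" using 0(1) by (metis degree_eq_zeroE)
    with 0(2) have a: "a \<noteq> 0" by simp
    from p 0(3) have "mat a ** V = 0" by (simp add: poly_mat_def)
    with a have "V = 0" by (simp add: vec_eq_iff mat_mult_nth)
    then show ?case by (intro exI[of _ "[]"]) simp
  next
    case (Suc d)
    then have "\<not> constant (poly p)" by (metis constant_degree old.nat.distinct(2))
    then obtain l where "poly p l = 0" using fundamental_theorem_of_algebra by blast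
    then obtain q where q: "p = [:- l, 1:] * q" by (auto simp: poly_eq_0_iff_dvd dvd_def)
    with Suc.prems have "q \<noteq> 0" by auto
    with q Suc.hyps(2) have "d = degree q" by (simp add: degree_mult_eq del: mult_pCons_left)
    moreover have "poly_mat q P ** ((P - mat l) ** V) = 0"
      using Suc.prems q by (simp add: poly_mat_linear_factor matrix_mul_assoc del: mult_pCons_left)
    ultimately obtain ls where ls: "\<forall>l\<in>set ls. \<exists>v. v \<noteq> 0 \<and> P *v v = l *s v"
        "foldl (\<lambda>V l. (P - mat l) ** V) ((P - mat l) ** V) ls = 0"
      using Suc.hyps(1)[of q] \<open>q \<noteq> 0\<close> by blast
    show ?case
    proof (cases "\<exists>v. v \<noteq> 0 \<and> P *v v = l *s v")
      case True
      then show ?thesis using ls by (intro exI[of _ "l # ls"]) simp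
    next
      case False
      then have inv: "invertible (P - mat l)"
        by (intro invertible_if_kernel_trivial)
           (auto simp: matrix_vector_mult_diff_rdistrib mat_mult_vector)
      \<comment> \<open>The factor is moved outside the remaining product, where its inverse can
        cancel it.\<close>
      have "(P - mat l) ** foldl (\<lambda>V l. (P - mat l) ** V) V ls = 0"
        using ls(2) by (subst (asm) foldl_factors_commute) (simp_all add: mm.diff_left mm.diff_right mat_commute)
      then have "matrix_inv (P - mat l) ** (P - mat l) ** foldl (\<lambda>V l. (P - mat l) ** V) V ls = 0"
        by (simp add: mm.zero_right flip: matrix_mul_assoc)
      then have "foldl (\<lambda>V l. (P - mat l) ** V) V ls = 0"
        by (simp add: matrix_inv_inverse[OF inv])
      with ls(1) show ?thesis by blast
    qed
  qed
  obtain c :: "nat \<Rightarrow> real" and N k where c: "k \<le> N" "c k \<noteq> 0" "(\<Sum>i\<le>N. c i *\<^sub>R mpow P i) = 0"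
    by (rule matrix_linear_dependence[of P])
  define p where "p = (\<Sum>i\<le>N. monom (complex_of_real (c i)) i)"
  have coeff: "coeff p i = (if i \<le> N then complex_of_real (c i) else 0)" for i
    by (simp add: p_def coeff_sum)
  have "p \<noteq> 0" using c(1,2) coeff by (metis coeff_0 of_real_eq_0_iff)
  moreover have "poly_mat p P = 0"
    using c(3) by (subst poly_mat_altdef[of _ N]) (auto intro!: degree_le simp: coeff mat_of_real_mult)
  ultimately obtain ls where ls: "\<forall>l\<in>set ls. \<exists>v. v \<noteq> 0 \<and> P *v v = l *s v"
      "foldl (\<lambda>V l. (P - mat l) ** V) (mat 1) ls = 0"
    using *[of p "mat 1"] by (auto simp: mm.zero_left)
  then have "foldl (\<lambda>V l. (P - mat l) ** V) V ls = 0" for V :: "complex^'n^'n"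
    using foldl_factors_mult[of P "mat 1" V ls] by (simp add: mm.zero_left)
  with ls(1) show ?thesis by blast
qed

text \<open>The kernel of \<open>T\<close> is invariant under \<open>P\<close>. When the
  annihilating factors act one after another on a matrix with columns in the kernel, every nonzero
  column of the last nonzero stage is an eigenvector.\<close>

lemma eigenvector_in_kernel:
  fixes P T :: "complex^'n^'n"
  assumes "T ** P = P ** T" "T *v v = 0" "v \<noteq> 0"
  obtains l u where "u \<noteq> 0" "P *v u = l *s u" "T *v u = 0"
proof -
  obtain ls where ls: "\<And>V :: complex^'n^'n. foldl (\<lambda>V l. (P - mat l) ** V) V ls = 0"
    using eigenvalue_factorisation[of P] by blast
  have *: "\<exists>l u. u \<noteq> 0 \<and> P *v u = l *s u \<and> T *v u = 0"
    if "foldl (\<lambda>V l. (P - mat l) ** V) V ls = 0" "V \<noteq> 0" "T ** V = 0" for V :: "complex^'n^'n" and ls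
    using that
  proof (induction ls arbitrary: V)
    case (Cons l ls)
    show ?case
    proof (cases "(P - mat l) ** V = 0")
      case True
      obtain j where j: "column j V \<noteq> 0"
        using Cons.prems(2) by (auto simp: column_def vec_eq_iff)
      have col: "M *v column j V = column j (M ** V)" for M :: "complex^'n^'n"
        by (simp add: vec_eq_iff column_def matrix_vector_mult_def matrix_matrix_mult_def)
      have "(P - mat l) *v column j V = 0" "T *v column j V = 0"
        by (simp_all only: col True Cons.prems(3)) (simp_all add: column_def vec_eq_iff)
      with j show ?thesis
        by (auto simp: matrix_vector_mult_diff_rdistrib mat_mult_vector)
    next
      case False
      have "T ** ((P - mat l) ** V) = (P - mat l) ** (T ** V)"
        using assms(1) by (simp add: matrix_mul_assoc mm.diff_left mm.diff_right mat_commute)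
      with Cons.prems have "T ** ((P - mat l) ** V) = 0" by (simp add: mm.zero_right)
      with Cons False show ?thesis by simp
    qed
  qed simp
  \<comment> \<open>Copying \<open>v\<close> into every column gives a matrix on which the factors
    can act.\<close>
  have "(\<chi> i j. v $ i) \<noteq> (0 :: complex^'n^'n)" "T ** (\<chi> i j. v $ i) = (0 :: complex^'n^'n)"
    using assms(2,3) by (simp_all add: vec_eq_iff matrix_vector_mult_def matrix_matrix_mult_def)
  from *[OF ls this] that show ?thesis by blast
qed

lemma bounded_linear_mat: "bounded_linear (mat :: complex \<Rightarrow> complex^'n^'n)"
  unfolding linear_conv_bounded_linear[symmetric]
  by (intro linearI) (simp_all add: mat_def vec_eq_iff)

text \<open>Induction over the factors: the bound known for (P - lI) V controls a derivative, and
  integrating it gives the bound for \<open>V\<close>. Since every Re l exceeds \<delta> strictly,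
  the same rate \<delta> survives each integration and no polynomial factor accumulates.\<close>

lemma mexp_decay:
  fixes P V :: "complex^'n^'n"
  assumes "foldl (\<lambda>V l. (P - mat l) ** V) V ls = 0" "\<And>l. l \<in> set ls \<Longrightarrow> \<delta> < Re l"
  shows "\<exists>C. \<forall>s\<ge>0. norm (mexp ((- s) *\<^sub>R P) ** V) \<le> C * exp (- (\<delta> * s))"
  using assms
proof (induction ls arbitrary: V)
  case Nil
  then show ?case by (intro exI[of _ 0]) (simp add: mm.zero_right)
next
  case (Cons l ls)
  obtain C where C: "\<And>s. s \<ge> 0 \<Longrightarrow> norm (mexp ((- s) *\<^sub>R P) ** ((P - mat l) ** V)) \<le> C * exp (- (\<delta> * s))"
    using Cons.IH[of "(P - mat l) ** V"] Cons.prems(1) Cons.prems(2)[OF list.set_intros(2)]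
    by fastforce
  have "C \<ge> 0" using order_trans[OF norm_ge_zero C[of 0]] by simp
  define r where "r = Re l - \<delta>"
  have "r > 0" using Cons.prems(2)[of l] by (simp add: r_def)
  \<comment> \<open>The integrating factor exp(l s) turns the \<open>P\<close> produced by
    differentiation into \<open>P - mat l\<close>, the factor covered by the induction
    hypothesis.\<close>
  define z where "z s = mat (exp (l * of_real s)) ** (mexp ((- s) *\<^sub>R P) ** V)" for s :: real
  define z' where "z' s = - (mat (exp (l * of_real s)) ** (mexp ((- s) *\<^sub>R P) ** ((P - mat l) ** V)))" for s :: real
  have z_der: "(z has_vector_derivative z' s) (at s)" for s
  proof -
    have 1: "((\<lambda>s. mexp ((- s) *\<^sub>R P)) has_vector_derivative (- 1) *\<^sub>R (P ** mexp ((- s) *\<^sub>R P))) (at s)"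
      by (rule vector_diff_chain_at[of uminus "- 1" s "\<lambda>s. mexp (s *\<^sub>R P)", unfolded o_def])
         (auto intro!: derivative_eq_intros mexp_scaleR_has_vector_derivative[of P "- s", simplified])
    have 2: "((\<lambda>s. mexp ((- s) *\<^sub>R P) ** V) has_vector_derivative ((- 1) *\<^sub>R (P ** mexp ((- s) *\<^sub>R P))) ** V) (at s)"
      by (rule bounded_linear.has_vector_derivative[OF mm.bounded_linear_left 1])
    have "((\<lambda>s. exp (l * of_real s)) has_vector_derivative l * exp (l * of_real s)) (at s)"
      by (rule has_vector_derivative_real_field) (auto intro!: derivative_eq_intros)
    then have 3: "((\<lambda>s. mat (exp (l * of_real s)) :: complex^'n^'n) has_vector_derivative mat (l * exp (l * of_real s))) (at s)"
      by (rule bounded_linear.has_vector_derivative[OF bounded_linear_mat])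
    have comm: "P ** mexp ((- s) *\<^sub>R P) = mexp ((- s) *\<^sub>R P) ** P"
      by (rule commute_mexp) (simp add: mm.minus_left mm.minus_right mm.scaleR_left mm.scaleR_right)
    have comm': "mexp ((- s) *\<^sub>R P) ** mat l = mat l ** mexp ((- s) *\<^sub>R P)" by (rule mat_commute)
    have "mat (exp (l * of_real s)) ** (((- 1) *\<^sub>R (P ** mexp ((- s) *\<^sub>R P))) ** V)
        + mat (l * exp (l * of_real s)) ** (mexp ((- s) *\<^sub>R P) ** V) = z' s"
    proof -
      have "mexp ((- s) *\<^sub>R P) ** ((P - mat l) ** V) =
          (P ** mexp ((- s) *\<^sub>R P)) ** V - mat l ** (mexp ((- s) *\<^sub>R P) ** V)"
        unfolding comm by (simp only: mm.diff_left mm.diff_right matrix_mul_assoc comm')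
      moreover have "mat (l * exp (l * of_real s)) = mat (exp (l * of_real s)) ** (mat l :: complex^'n^'n)"
        by (simp add: mat_mult_mat mult.commute)
      ultimately show ?thesis
        by (simp add: z'_def mm.diff_right mm.minus_left mm.minus_right flip: matrix_mul_assoc)
    qed
    then show ?thesis unfolding z_def using mm.has_vector_derivative[OF 3 2] by simp
  qed
  have z'_le: "norm (z' s) \<le> C * exp (r * s)" if "s \<ge> 0" for s
  proof -
    have "norm (z' s) \<le> exp (Re l * s) * (C * exp (- (\<delta> * s)))"
      using C[OF that] by (simp add: z'_def norm_mat_mult)
    also have "\<dots> = C * exp (r * s)" by (simp add: r_def algebra_simps flip: exp_add)
    finally show ?thesis .
  qed
  \<comment> \<open>\<open>C / r\<close> comes from integrating C exp(r x) from 0 to s.\<close>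
  have "norm (mexp ((- s) *\<^sub>R P) ** V) \<le> (norm V + C / r) * exp (- (\<delta> * s))" if "s \<ge> 0" for s
  proof -
    have "norm (z s - z 0) \<le> C / r * exp (r * s) - C / r * exp (r * 0)"
    proof (cases "s = 0")
      case False
      show ?thesis
      proof (rule differentiable_bound_general[where f' = z' and \<phi>' = "\<lambda>s. C * exp (r * s)"])
        show "0 < s" using False that by simp
        show "continuous_on {0..s} z"
          using z_der by (meson continuous_at_imp_continuous_on has_vector_derivative_continuous)
        show "continuous_on {0..s} (\<lambda>s. C / r * exp (r * s))" by (intro continuous_intros)
        show "((\<lambda>s. C / r * exp (r * s)) has_vector_derivative C * exp (r * x)) (at x)" for x
          using \<open>r > 0\<close>
          by (auto intro!: derivative_eq_intros simp flip: has_real_derivative_iff_has_vector_derivative)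
      qed (use z_der z'_le in auto)
    qed simp
    moreover have "z 0 = V" by (simp add: z_def mexp_zero)
    moreover have "C / r \<ge> 0" using \<open>C \<ge> 0\<close> \<open>r > 0\<close> by simp
    moreover have "norm (z s) \<le> norm (z s - z 0) + norm (z 0)" using norm_triangle_ineq[of "z s - z 0" "z 0"] by simp
    moreover have "norm V \<le> norm V * exp (r * s)" using \<open>r > 0\<close> that by (simp add: mult_le_cancel_left1)
    ultimately have "norm (z s) \<le> (norm V + C / r) * exp (r * s)" by (simp add: algebra_simps)
    then have "exp (- (Re l * s)) * norm (z s) \<le> exp (- (Re l * s)) * ((norm V + C / r) * exp (r * s))" by simp
    also have "\<dots> = (norm V + C / r) * exp (- (\<delta> * s))" by (simp add: r_def algebra_simps flip: exp_add)
    also have "exp (- (Re l * s)) * norm (z s) = norm (mexp ((- s) *\<^sub>R P) ** V)"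
      by (simp add: z_def norm_mat_mult exp_minus)
    finally show ?thesis .
  qed
  then show ?case by blast
qed

lemma positive_stable_mexp_decay:
  fixes P :: "complex^'n^'n"
  assumes "positive_stable P"
  shows "\<exists>C \<delta>. \<delta> > 0 \<and> (\<forall>s\<ge>0. norm (mexp ((- s) *\<^sub>R P)) \<le> C * exp (- (\<delta> * s)))"
proof -
  obtain ls where ls: "\<And>l. l \<in> set ls \<Longrightarrow> \<exists>v. v \<noteq> 0 \<and> P *v v = l *s v"
    "\<And>V :: complex^'n^'n. foldl (\<lambda>V l. (P - mat l) ** V) V ls = 0"
    using eigenvalue_factorisation[of P] by blast
  \<comment> \<open>Half of the least real part leaves the strict gap that \<open>mexp_decay\<close>
    demands; the inserted 2 keeps the set nonempty.\<close>
  define \<delta> where "\<delta> = Min (insert 2 (Re ` set ls)) / 2"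
  have pos: "\<forall>l\<in>set ls. 0 < Re l" using ls(1) assms by (auto simp: positive_stable_def)
  then have "\<delta> > 0" by (simp add: \<delta>_def)
  have "\<delta> < Re l" if "l \<in> set ls" for l
  proof -
    have "2 * \<delta> \<le> Re l" using that by (simp add: \<delta>_def)
    with \<open>\<delta> > 0\<close> show ?thesis by simp
  qed
  then obtain C where "\<And>s. s \<ge> 0 \<Longrightarrow> norm (mexp ((- s) *\<^sub>R P) ** mat 1) \<le> C * exp (- (\<delta> * s))"
    using mexp_decay[OF ls(2), of \<delta> "mat 1"] by blast
  with \<open>\<delta> > 0\<close> show ?thesis by auto
qed

section \<open>The matrix Gamma function\<close>

lemma rpow_add_mat:
  assumes "t > 0"
  shows "rpow t (P + mat (of_real c)) = t powr c *\<^sub>R rpow t P"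
  using assms by (simp add: rpow_def mexp_add_mat powr_def mult.commute)

lemma rpow_diff_1:
  assumes "t > 0"
  shows "rpow t (P - mat 1) = (1 / t) *\<^sub>R rpow t P"
proof -
  have "P - mat 1 = P + mat (of_real (- 1))" by (simp add: vec_eq_iff mat_def)
  with assms show ?thesis by (simp only: rpow_add_mat powr_neg_one)
qed

lemma commute_rpow:
  assumes "X ** P = P ** X"
  shows "X ** rpow t P = rpow t P ** X"
  unfolding rpow_def by (rule commute_mexp) (simp add: assms mm.scaleR_left mm.scaleR_right)

lemma rpow_has_vector_derivative:
  assumes "t > 0"
  shows "((\<lambda>t. rpow t P) has_vector_derivative P ** rpow t (P - mat 1)) (at t)"
proof -
  have "((\<lambda>t. rpow t P) has_vector_derivative (1 / t) *\<^sub>R (P ** mexp (ln t *\<^sub>R P))) (at t)"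
    unfolding rpow_def
    by (rule vector_diff_chain_at[of ln "1 / t" t "\<lambda>s. mexp (s *\<^sub>R P)", unfolded o_def])
       (use assms in \<open>auto intro!: derivative_eq_intros mexp_scaleR_has_vector_derivative
         simp: field_simps simp flip: has_real_derivative_iff_has_vector_derivative\<close>)
  then show ?thesis using assms by (simp only: rpow_diff_1 mm.scaleR_right) (simp add: rpow_def)
qed

lemma continuous_on_rpow: "continuous_on {0<..} (\<lambda>t. rpow t P)"
  by (intro continuous_at_imp_continuous_on ballI
      has_vector_derivative_continuous[OF rpow_has_vector_derivative]) auto

lemma norm_rpow_le_at_top:
  fixes P :: "complex^'n^'n"
  shows "\<exists>\<kappa>\<ge>0. \<forall>t\<ge>1. norm (rpow t P) \<le> norm (mat 1 :: complex^'n^'n) * t powr \<kappa>"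
proof -
  obtain K where K: "K \<ge> 0" "\<And>M::complex^'n^'n. norm (mexp M) \<le> exp (K * norm M) * norm (mat 1 :: complex^'n^'n)"
    using norm_mexp_le by blast
  have "norm (rpow t P) \<le> norm (mat 1 :: complex^'n^'n) * t powr (K * norm P)" if "t \<ge> 1" for t
    using K(2)[of "ln t *\<^sub>R P"] that by (simp add: rpow_def powr_def mult_ac)
  with K(1) show ?thesis by (intro exI[of _ "K * norm P"]) simp
qed

text \<open>Substituting t = exp(-s) turns exponential decay into a positive power of t, which makes
  t^(P - I) integrable at 0.\<close>

lemma norm_rpow_le_at_0:
  fixes P :: "complex^'n^'n"
  assumes "positive_stable P"
  shows "\<exists>C \<delta>. C \<ge> 0 \<and> \<delta> > 0 \<and> (\<forall>t. 0 < t \<longrightarrow> t \<le> 1 \<longrightarrow> norm (rpow t P) \<le> C * t powr \<delta>)"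
proof -
  obtain C \<delta> where C: "\<delta> > 0" "\<And>s. s \<ge> 0 \<Longrightarrow> norm (mexp ((- s) *\<^sub>R P)) \<le> C * exp (- (\<delta> * s))"
    using positive_stable_mexp_decay[OF assms] by blast
  have "norm (rpow t P) \<le> C * t powr \<delta>" if "0 < t" "t \<le> 1" for t
    using C(2)[of "- ln t"] that by (simp add: rpow_def powr_def)
  moreover have "C \<ge> 0" using order_trans[OF norm_ge_zero C(2)[of 0]] by simp
  ultimately show ?thesis using C(1) by blast
qed

lemma mGamma_absolutely_integrable:
  fixes P :: "complex^'n^'n"
  assumes "positive_stable P"
  shows "(\<lambda>t. exp (- t) *\<^sub>R rpow t (P - mat 1)) absolutely_integrable_on {0<..}"
proof -
  obtain \<kappa> where k: "\<kappa> \<ge> 0" "\<And>t. t \<ge> 1 \<Longrightarrow> norm (rpow t P) \<le> norm (mat 1 :: complex^'n^'n) * t powr \<kappa>"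
    using norm_rpow_le_at_top[of P] by blast
  obtain C \<delta> where d: "C \<ge> 0" "\<delta> > 0" "\<And>t. 0 < t \<Longrightarrow> t \<le> 1 \<Longrightarrow> norm (rpow t P) \<le> C * t powr \<delta>"
    using norm_rpow_le_at_0[OF assms] by blast
  let ?N = "norm (mat 1 :: complex^'n^'n)"
  \<comment> \<open>Scalar Gamma integrands at \<delta>, for small t, and at \<kappa> + 1, for large
    t; the added 1 keeps the argument positive if \<kappa> = 0.\<close>
  let ?g = "\<lambda>t. C * (t powr (\<delta> - 1) / exp t) + ?N * (t powr (\<kappa> + 1 - 1) / exp t)"
  have int: "(\<lambda>t. t powr (x - 1) / exp t) integrable_on {0<..}" if "x > 0" for x :: real
    by (rule integrable_spike_set[OF has_integral_integrable[OF Gamma_integral_real[OF that]]])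
       (auto intro: negligible_subset[of "{0}"])
  show ?thesis
  proof (rule measurable_bounded_by_integrable_imp_absolutely_integrable)
    show "(\<lambda>t. exp (- t) *\<^sub>R rpow t (P - mat 1)) \<in> borel_measurable (lebesgue_on {0<..})"
      by (intro continuous_imp_measurable_on_sets_lebesgue continuous_intros continuous_on_rpow) auto
    show "?g integrable_on {0<..}"
      using d(2) k(1) by (intro integrable_add integrable_on_mult_right int) auto
    fix t :: real assume "t \<in> {0<..}"
    then have t: "t > 0" by simp
    have "norm (rpow t P) \<le> C * t powr \<delta> + ?N * t powr (\<kappa> + 1)"
    proof (cases "t \<le> 1")
      case True
      have "norm (rpow t P) \<le> C * t powr \<delta>" by (rule d(3)[OF t True])
      moreover have "0 \<le> ?N * t powr (\<kappa> + 1)" by simp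
      ultimately show ?thesis by linarith
    next
      case False
      have "norm (rpow t P) \<le> ?N * t powr \<kappa>" using False by (intro k(2)) auto
      also have "\<dots> \<le> ?N * t powr (\<kappa> + 1)" using False by (intro mult_left_mono powr_mono) auto
      finally have "norm (rpow t P) \<le> ?N * t powr (\<kappa> + 1)" .
      moreover have "0 \<le> C * t powr \<delta>" using d(1) by simp
      ultimately show ?thesis by linarith
    qed
    then have "norm (rpow t P) / (t * exp t) \<le> (C * t powr \<delta> + ?N * t powr (\<kappa> + 1)) / (t * exp t)"
      using t by (intro divide_right_mono) auto
    then show "norm (exp (- t) *\<^sub>R rpow t (P - mat 1)) \<le> ?g t"
      using t by (simp add: rpow_diff_1 exp_minus powr_diff powr_add field_simps)
  qed simp
qed

lemma mGamma_has_integral: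
  assumes "positive_stable P"
  shows "((\<lambda>t. exp (- t) *\<^sub>R rpow t (P - mat 1)) has_integral mGamma P) {0<..}"
  unfolding mGamma_def
  by (intro integrable_integral set_lebesgue_integral_eq_integral(1) mGamma_absolutely_integrable assms)

text \<open>On a box [a, b] around 0 the integral is G(b) - G(0), so the gauge integral over the
  half-line is governed by the limit of the primitive alone.\<close>

lemma has_integral_FTC_at_top:
  fixes G :: "real \<Rightarrow> 'a::banach"
  assumes "continuous_on {0..} G"
    and "\<And>t. t > 0 \<Longrightarrow> (G has_vector_derivative f t) (at t)"
    and "(G \<longlongrightarrow> L) at_top"
  shows "(f has_integral (L - G 0)) {0<..}"
proof (subst has_integral_alt', intro conjI allI impI)
  have ivl: "((\<lambda>x. if x \<in> {0<..} then f x else 0) has_integral (G b - G 0)) {a..b}" if "a \<le> 0" "0 \<le> b" for a b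
  proof -
    have "(f has_integral (G b - G 0)) {0..b}"
      using assms(1,2) that by (intro fundamental_theorem_of_calculus_interior) (auto elim: continuous_on_subset)
    then have "((\<lambda>x. if x \<in> {0..b} then f x else 0) has_integral (G b - G 0)) UNIV"
      unfolding has_integral_restrict_UNIV .
    then have "((\<lambda>x. if x \<in> {a..b} then if x \<in> {0<..} then f x else 0 else 0) has_integral (G b - G 0)) UNIV"
      by (rule has_integral_spike[of "{0}", rotated 2]) (use that in auto)
    then show ?thesis unfolding has_integral_restrict_UNIV .
  qed
  show "(\<lambda>x. if x \<in> {0<..} then f x else 0) integrable_on cbox a b" for a b
    by (rule integrable_subinterval_real[OF has_integral_integrable[OF ivl[of "min a 0" "max b 0"]], of a b, folded box_real]) auto
  fix e :: real assume "e > 0"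
  then have "\<forall>\<^sub>F b in at_top. dist (G b) L < e" using assms(3) by (auto simp: tendsto_iff)
  then obtain B where B: "\<And>b. b \<ge> B \<Longrightarrow> dist (G b) L < e" by (auto simp: eventually_at_top_linorder)
  \<comment> \<open>Such a box contains 0 and \<open>max 1 B\<close>, so its right end is at least
    \<open>B\<close>; the 1 keeps the radius positive.\<close>
  have "norm (integral (cbox a b) (\<lambda>x. if x \<in> {0<..} then f x else 0) - (L - G 0)) < e"
    if "ball 0 (max 1 B + 1) \<subseteq> cbox a b" for a b
  proof -
    have "0 \<in> ball 0 (max 1 B + 1)" "max 1 B \<in> ball 0 (max 1 B + 1)" by auto
    with that have "0 \<in> cbox a b" "max 1 B \<in> cbox a b" by blast+
    then have "a \<le> 0" "0 \<le> b" "B \<le> b" by auto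
    then show ?thesis using integral_unique[OF ivl, of a b] B[of b] by (simp add: dist_norm)
  qed
  then show "\<exists>B>0. \<forall>a b. ball 0 B \<subseteq> cbox a b \<longrightarrow>
      norm (integral (cbox a b) (\<lambda>x. if x \<in> {0<..} then f x else 0) - (L - G 0)) < e"
    by (intro exI[of _ "max 1 B + 1"]) auto
qed

text \<open>Integration by parts: the derivative of exp(-t) t^P is the difference of the two Gamma
  integrands, and exp(-t) t^P vanishes at both ends.\<close>

lemma mGamma_add_1:
  fixes P :: "complex^'n^'n"
  assumes "positive_stable P"
  shows "mGamma (P + mat 1) = P ** mGamma P"
proof -
  \<comment> \<open>The value 0 for t \<le> 0 is set by hand to make \<open>G\<close> continuous at
    the origin.\<close>
  define G where "G t = (if t \<le> 0 then 0 else exp (- t) *\<^sub>R rpow t P)" for t :: real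
  let ?N = "norm (mat 1 :: complex^'n^'n)"
  obtain \<kappa> where k: "\<kappa> \<ge> 0" "\<And>t. t \<ge> 1 \<Longrightarrow> norm (rpow t P) \<le> ?N * t powr \<kappa>"
    using norm_rpow_le_at_top[of P] by blast
  obtain C \<delta> where d: "C \<ge> 0" "\<delta> > 0" "\<And>t. 0 < t \<Longrightarrow> t \<le> 1 \<Longrightarrow> norm (rpow t P) \<le> C * t powr \<delta>"
    using norm_rpow_le_at_0[OF assms] by blast
  have der: "(G has_vector_derivative (exp (- t) *\<^sub>R (P ** rpow t (P - mat 1)) - exp (- t) *\<^sub>R rpow t P)) (at t)"
    if "t > 0" for t
  proof (rule has_vector_derivative_transform_within_open[where S = "{0<..}"])
    have "((\<lambda>t. exp (- t) *\<^sub>R rpow t P) has_vector_derivative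
        exp (- t) *\<^sub>R (P ** rpow t (P - mat 1)) + (- exp (- t)) *\<^sub>R rpow t P) (at t)"
      by (rule bounded_bilinear.has_vector_derivative[OF bounded_bilinear_scaleR _ rpow_has_vector_derivative[OF that]])
         (auto intro!: derivative_eq_intros simp flip: has_real_derivative_iff_has_vector_derivative)
    then show "((\<lambda>t. exp (- t) *\<^sub>R rpow t P) has_vector_derivative
        exp (- t) *\<^sub>R (P ** rpow t (P - mat 1)) - exp (- t) *\<^sub>R rpow t P) (at t)" by simp
  qed (use that in \<open>auto simp: G_def\<close>)
  have "continuous_on {0..} G"
  proof (unfold continuous_on_eq_continuous_within, rule ballI)
    fix t :: real assume "t \<in> {0..}"
    show "continuous (at t within {0..}) G"
    proof (cases "t = 0")
      case False
      with \<open>t \<in> {0..}\<close> have "isCont G t" using der[of t] has_vector_derivative_continuous by auto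
      then show ?thesis by (rule continuous_at_imp_continuous_at_within)
    next
      case True
      have "(G \<longlongrightarrow> 0) (at_right 0)"
      proof (rule Lim_null_comparison)
        show "\<forall>\<^sub>F t in at_right 0. norm (G t) \<le> C * t powr \<delta>"
          unfolding eventually_at_right_field
        proof (intro exI[of _ 1] conjI allI impI)
          fix t :: real assume t: "0 < t" "t < 1"
          have "exp (- t) * norm (rpow t P) \<le> 1 * norm (rpow t P)" using t by (intro mult_right_mono) auto
          also have "\<dots> \<le> C * t powr \<delta>" using d(3)[of t] t by simp
          finally show "norm (G t) \<le> C * t powr \<delta>" using t by (simp add: G_def)
        qed simp
        show "((\<lambda>t. C * t powr \<delta>) \<longlongrightarrow> 0) (at_right 0)"
          using d(2) by real_asymp
      qed
      then show ?thesis by (simp add: True continuous_within G_def at_within_Ici_at_right)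
    qed
  qed
  moreover have "(G \<longlongrightarrow> 0) at_top"
  proof (rule Lim_null_comparison)
    show "\<forall>\<^sub>F t in at_top. norm (G t) \<le> exp (- t) * (?N * t powr \<kappa>)"
      using eventually_ge_at_top[of 1] by eventually_elim (auto simp: G_def k(2))
    show "((\<lambda>t. exp (- t) * (?N * t powr \<kappa>)) \<longlongrightarrow> 0) at_top"
      by real_asymp
  qed
  ultimately have I: "((\<lambda>t. exp (- t) *\<^sub>R (P ** rpow t (P - mat 1)) - exp (- t) *\<^sub>R rpow t P) has_integral (0 - G 0)) {0<..}"
    using has_integral_FTC_at_top[OF _ der] by blast
  have "((\<lambda>t. exp (- t) *\<^sub>R (P ** rpow t (P - mat 1))) has_integral P ** mGamma P) {0<..}"
    using has_integral_linear[OF mGamma_has_integral[OF assms] mm.bounded_linear_right[of P]]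
    by (simp add: o_def mm.scaleR_right)
  from has_integral_diff[OF this I]
  have "((\<lambda>t. exp (- t) *\<^sub>R rpow t ((P + mat 1) - mat 1)) has_integral P ** mGamma P) {0<..}"
    by (simp add: G_def)
  then show ?thesis by (simp add: mGamma_def integral_unique)
qed

text \<open>Integrability is no premise: otherwise the integral is 0, which commutes with
  everything. This is what makes it applicable to \<open>ext_mBeta\<close>.\<close>

lemma commute_integral:
  fixes f :: "'b::euclidean_space \<Rightarrow> complex^'n^'n"
  assumes "\<And>t. t \<in> S \<Longrightarrow> X ** f t = f t ** X"
  shows "X ** integral S f = integral S f ** X"
proof (cases "f integrable_on S")
  case True
  have "X ** integral S f = integral S (\<lambda>t. X ** f t)"
    using integral_linear[OF True mm.bounded_linear_right[of X]] by (simp add: o_def)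
  also have "\<dots> = integral S (\<lambda>t. f t ** X)" by (intro integral_cong assms)
  also have "\<dots> = integral S f ** X"
    using integral_linear[OF True mm.bounded_linear_left[of X]] by (simp add: o_def)
  finally show ?thesis .
qed (simp add: not_integrable_integral mm.zero_left mm.zero_right)

lemma commute_diff_mat:
  fixes X P :: "complex^'n^'n"
  assumes "X ** P = P ** X"
  shows "X ** (P - mat c) = (P - mat c) ** X"
  by (simp add: mm.diff_left mm.diff_right assms mat_commute)

lemma commute_mGamma:
  assumes "X ** P = P ** X"
  shows "X ** mGamma P = mGamma P ** X"
  unfolding mGamma_def
  by (intro commute_integral)
     (simp add: mm.scaleR_left mm.scaleR_right commute_rpow[OF commute_diff_mat[OF assms]])

lemma mGamma_add_nat:
  fixes P :: "complex^'n^'n"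
  assumes "positive_stable P"
  shows "mGamma (P + mat (of_nat k)) = mpochhammer P k ** mGamma P"
proof (induction k)
  case (Suc k)
  have "mGamma (P + mat (of_nat (Suc k))) = (P + mat (of_nat k)) ** mGamma (P + mat (of_nat k))"
    using mGamma_add_1[OF positive_stable_add_nat[OF assms, of k]]
    by (simp add: mat_add add.assoc add.commute[of 1])
  also have "\<dots> = mpochhammer P (Suc k) ** mGamma P"
    unfolding Suc mpochhammer.simps matrix_mul_assoc
    by (simp add: commute_mpochhammer[of "P + mat (of_nat k)" P k] commute_add_mat[of P P, symmetric])
  finally show ?case .
next
  case 0
  have "mat 0 = (0 :: complex^'n^'n)" by (simp add: mat_def vec_eq_iff)
  then show ?case by simp
qed

section \<open>Action on eigenvectors and invertibility of Gamma(P)\<close>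

lemma mpow_eigenvector:
  assumes "X *v u = \<mu> *s u"
  shows "mpow X n *v u = (\<mu> ^ n) *s u"
  by (induction n) (simp_all add: assms vector_scalar_commute mult.commute flip: matrix_vector_mul_assoc)

lemma mexp_eigenvector:
  fixes X :: "complex^'n^'n"
  assumes "X *v u = \<mu> *s u"
  shows "mexp X *v u = exp \<mu> *s u"
proof -
  have "(\<lambda>n. ((1 / fact n) *\<^sub>R mpow X n) *v u) sums (mexp X *v u)"
    by (rule bounded_linear.sums[OF mv.bounded_linear_left mexp_sums])
  moreover have "((1 / fact n) *\<^sub>R mpow X n) *v u = (\<mu> ^ n /\<^sub>R fact n) *s u" for n
    by (simp add: mv.scaleR_left mpow_eigenvector[OF assms] vec_eq_iff field_simps)
  moreover have "(\<lambda>n. (\<mu> ^ n /\<^sub>R fact n) *s u) sums (exp \<mu> *s u)"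
  proof (rule bounded_linear.sums[OF _ exp_converges])
    show "bounded_linear (\<lambda>c :: complex. c *s u)"
      unfolding linear_conv_bounded_linear[symmetric]
      by (intro linearI) (simp_all add: vec_eq_iff algebra_simps)
  qed
  ultimately show ?thesis by (simp add: sums_unique2)
qed

lemma invertible_mGamma:
  fixes P :: "complex^'n^'n"
  assumes "positive_stable P"
  shows "invertible (mGamma P)"
proof (rule invertible_if_kernel_trivial, rule ccontr)
  fix v assume v: "mGamma P *v v = 0" "v \<noteq> 0"
  have "mGamma P ** P = P ** mGamma P" by (rule commute_mGamma[symmetric]) simp
  from eigenvector_in_kernel[OF this v] obtain l u where
    u: "u \<noteq> 0" "P *v u = l *s u" "mGamma P *v u = 0" by blast
  have "Re l > 0" using assms u by (auto simp: positive_stable_def)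
  have e: "exp (- t) *\<^sub>R rpow t (P - mat 1) *v u = (of_real t powr (l - 1) / of_real (exp t)) *s u" if "t > 0" for t
  proof -
    have "(ln t *\<^sub>R (P - mat 1)) *v u = (of_real (ln t) * (l - 1)) *s u"
      using u(2) by (simp add: mv.scaleR_left matrix_vector_mult_diff_rdistrib vec_eq_iff scaleR_conv_of_real[where 'a = complex] algebra_simps)
    from mexp_eigenvector[OF this] show ?thesis
      using that by (simp add: rpow_def mv.scaleR_left powr_def Ln_of_real vec_eq_iff
          scaleR_conv_of_real[where 'a = complex] exp_minus exp_of_real field_simps)
  qed
  have h: "((\<lambda>t. exp (- t) *\<^sub>R rpow t (P - mat 1) *v u) has_integral mGamma P *v u) {0<..}"
    using has_integral_linear[OF mGamma_has_integral[OF assms] mv.bounded_linear_left[of u]] by (simp add: o_def)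
  have 1: "((\<lambda>t. (of_real t powr (l - 1) / of_real (exp t)) *s u) has_integral 0) {0<..}"
    by (rule has_integral_eq[OF _ h[unfolded u(3)]]) (simp only: greaterThan_iff e)
  have "bounded_linear (\<lambda>c :: complex. c *s u)"
    unfolding linear_conv_bounded_linear[symmetric]
    by (intro linearI) (simp_all add: vec_eq_iff algebra_simps)
  from has_integral_linear[OF Gamma_integral_complex'[OF \<open>Re l > 0\<close>] this]
  have 2: "((\<lambda>t. (of_real t powr (l - 1) / of_real (exp t)) *s u) has_integral Gamma l *s u) {0<..}"
    by (simp add: o_def)
  have "Gamma l *s u = 0" by (rule has_integral_unique[OF 2 1])
  then have "Gamma l = 0" using u(1) by simp
  \<comment> \<open>By convention \<open>Gamma\<close> takes the value 0 exactly at its poles, and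
    these have real part at most 0.\<close>
  then have "l \<in> \<int>\<^sub>\<le>\<^sub>0" by (simp add: Gamma_eq_zero_iff)
  with \<open>Re l > 0\<close> show False by (auto elim!: nonpos_Ints_cases)
qed

section \<open>Beta quotients under integer shifts\<close>

lemma invertible_mBeta:
  assumes "positive_stable P" "positive_stable Q" "positive_stable (P + Q)"
  shows "invertible (mBeta P Q)"
  unfolding mBeta_def by (intro invertible_mult invertible_matrix_inv invertible_mGamma assms)

text \<open>In effect B(P + kI, Q) is (P)_k B(P, Q) times the inverse of (P + Q)_k. At P = B1 and Q
  = C1 - B1 this lets (B1)_m and the inverse of (C1)_m absorb the shift of the beta
  denominator.\<close>

lemma matrix_inv_mBeta_add_nat:
  fixes P Q :: "complex^'n^'n"
  assumes stable: "positive_stable P" "positive_stable Q" "positive_stable (P + Q)" and "P ** Q = Q ** P"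
  shows "matrix_inv (mBeta (P + mat (of_nat k)) Q) ** mpochhammer P k ** matrix_inv (mpochhammer (P + Q) k)
       = matrix_inv (mBeta P Q)"
proof -
  let ?p = "mpochhammer P k" and ?c = "mpochhammer (P + Q) k"
  note inv = invertible_mpochhammer[OF stable(1), of k] invertible_mpochhammer[OF stable(3), of k]
  have PQ: "P ** (P + Q) = (P + Q) ** P"
    using assms(4) by (simp add: mm.add_left mm.add_right)
  have pc: "?p ** ?c = ?c ** ?p"
    by (intro commute_mpochhammer[OF commute_mpochhammer[OF PQ[symmetric], symmetric]])
  have GG: "mGamma (P + Q) ** ?c = ?c ** mGamma (P + Q)"
    by (rule commute_mpochhammer[OF commute_mGamma[symmetric]]) simp
  have "mBeta (P + mat (of_nat k)) Q = ?p ** (mGamma P ** mGamma Q ** matrix_inv (mGamma (P + Q + mat (of_nat k))))"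
    by (simp add: mBeta_def mGamma_add_nat[OF stable(1)] matrix_mul_assoc add_ac)
  also have "mGamma (P + Q + mat (of_nat k)) = mGamma (P + Q) ** ?c"
    by (simp add: mGamma_add_nat[OF stable(3)] GG)
  also have "matrix_inv (mGamma (P + Q) ** ?c) = matrix_inv ?c ** matrix_inv (mGamma (P + Q))"
    by (intro matrix_inv_mult invertible_mGamma stable inv)
  also have "\<dots> = matrix_inv (mGamma (P + Q)) ** matrix_inv ?c"
    by (intro matrix_inv_commute matrix_inv_commute[symmetric] inv invertible_mGamma stable GG[symmetric])
  also have "?p ** (mGamma P ** mGamma Q ** (matrix_inv (mGamma (P + Q)) ** matrix_inv ?c)) = ?p ** mBeta P Q ** matrix_inv ?c"
    by (simp add: mBeta_def matrix_mul_assoc)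
  finally have "matrix_inv (mBeta (P + mat (of_nat k)) Q) = ?c ** (matrix_inv (mBeta P Q) ** matrix_inv ?p)"
    using inv by (simp add: matrix_inv_mult invertible_mult invertible_mBeta stable invertible_matrix_inv matrix_inv_matrix_inv)
  moreover have "mGamma P ** ?c = ?c ** mGamma P" "mGamma Q ** ?c = ?c ** mGamma Q"
    using assms(4) by (auto intro!: commute_mpochhammer[symmetric] commute_mGamma[symmetric] simp: mm.add_left mm.add_right)
  then have "mBeta P Q ** ?c = ?c ** mBeta P Q"
    unfolding mBeta_def using GG
    by (metis invertible_mGamma matrix_inv_commute matrix_mult_commute stable(3))
  then have "matrix_inv (mBeta P Q) ** ?c = ?c ** matrix_inv (mBeta P Q)"
    by (intro matrix_inv_commute invertible_mBeta stable)
  moreover have "matrix_inv ?p ** ?c = ?c ** matrix_inv ?p" by (intro matrix_inv_commute inv pc)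
  ultimately have "matrix_inv (mBeta (P + mat (of_nat k)) Q) = matrix_inv (mBeta P Q) ** ?c ** matrix_inv ?p"
    by (simp add: matrix_mul_assoc)
  then have "matrix_inv (mBeta (P + mat (of_nat k)) Q) ** ?p ** matrix_inv ?c
     = matrix_inv (mBeta P Q) ** (?c ** (matrix_inv ?p ** ?p) ** matrix_inv ?c)"
    by (simp add: matrix_mul_assoc)
  then show ?thesis by (simp add: matrix_inv_inverse inv)
qed

section \<open>The extended beta matrix function\<close>

lemma norm_mpochhammer_le:
  fixes M :: "complex^'n^'n"
  shows "\<exists>\<alpha>>0. \<forall>k. norm (mpochhammer M k) \<le> norm (mat 1 :: complex^'n^'n) * pochhammer \<alpha> k"
proof -
  obtain K where K: "K \<ge> 0" "\<And>(M::complex^'n^'n) (N::complex^'n^'n). norm (M ** N) \<le> K * norm M * norm N"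
    using norm_matrix_mult_le by blast
  \<comment> \<open>The added 1 keeps \<alpha> positive even if \<open>M\<close> is 0.\<close>
  define \<alpha> where "\<alpha> = K * norm M + 1"
  have "\<alpha> > 0" using K(1) by (simp add: \<alpha>_def add_nonneg_pos)
  have "norm (mpochhammer M k) \<le> norm (mat 1 :: complex^'n^'n) * pochhammer \<alpha> k" for k
  proof (induction k)
    case (Suc k)
    have "norm (mpochhammer M (Suc k)) \<le> norm (mpochhammer M k ** M) + norm (real k *\<^sub>R mpochhammer M k)"
      by (simp only: mpochhammer.simps mm.add_right mat_commute mat_of_nat_mult norm_triangle_ineq)
    also have "\<dots> \<le> K * norm (mpochhammer M k) * norm M + real k * norm (mpochhammer M k)"
      using K(2)[of "mpochhammer M k" M] by simp
    also have "\<dots> \<le> norm (mpochhammer M k) * (\<alpha> + real k)"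
      by (simp add: \<alpha>_def algebra_simps)
    also have "\<dots> \<le> norm (mat 1 :: complex^'n^'n) * pochhammer \<alpha> k * (\<alpha> + real k)"
      using \<open>\<alpha> > 0\<close> by (intro mult_right_mono Suc) auto
    finally show ?case by (simp add: pochhammer_Suc mult_ac)
  qed simp
  with \<open>\<alpha> > 0\<close> show ?thesis by blast
qed

text \<open>The inverse X satisfies k X = I - B X, so its norm is at most a constant over k - K
  norm(B). This decay drives the ratio test for \<open>hyp1F1\<close>.\<close>

lemma norm_matrix_inv_add_nat_tendsto_0:
  fixes B :: "complex^'n^'n"
  assumes "positive_stable B"
  shows "(\<lambda>k. norm (matrix_inv (B + mat (of_nat k)))) \<longlonglongrightarrow> 0"
proof -
  obtain K where K: "K \<ge> 0" "\<And>(M::complex^'n^'n) (N::complex^'n^'n). norm (M ** N) \<le> K * norm M * norm N"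
    using norm_matrix_mult_le by blast
  let ?N = "norm (mat 1 :: complex^'n^'n)"
  have bound: "norm (matrix_inv (B + mat (of_nat k))) \<le> ?N / (real k - K * norm B)"
    if "real k > K * norm B" for k
  proof -
    let ?X = "matrix_inv (B + mat (of_nat k))"
    have "(B + mat (of_nat k)) ** ?X = mat 1"
      by (intro matrix_inv_inverse positive_stable_invertible positive_stable_add_nat assms)
    then have "real k *\<^sub>R ?X = mat 1 - B ** ?X"
      by (simp add: mm.add_left mat_of_nat_mult eq_diff_eq add.commute)
    then have "real k * norm ?X = norm (mat 1 - B ** ?X)" by (metis abs_of_nat norm_scaleR)
    also have "\<dots> \<le> ?N + K * norm B * norm ?X"
      using norm_triangle_ineq4[of "mat 1" "B ** ?X"] K(2)[of B ?X] by linarith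
    finally show ?thesis using that by (simp add: field_simps)
  qed
  show ?thesis
  proof (rule Lim_null_comparison)
    show "\<forall>\<^sub>F k in sequentially. norm (norm (matrix_inv (B + mat (of_nat k)))) \<le> ?N / (real k - K * norm B)"
      unfolding real_norm_def abs_norm_cancel
      using filterlim_real_sequentially[unfolded filterlim_at_top_dense, rule_format, of "K * norm B"]
      by (rule eventually_mono) (rule bound)
    show "(\<lambda>k. ?N / (real k - K * norm B)) \<longlonglongrightarrow> 0" by real_asymp
  qed
qed

text \<open>Consecutive terms of the majorant have ratio (\<alpha> + n) / (n + 1) times \<omega>
  times \<open>\<beta> n\<close>, which tends to 0 for every argument \<open>W\<close>. Convergence
  is what lets commutation pass from the terms to the sum.\<close>

lemma hyp1F1_sums:
  fixes A B W :: "complex^'n^'n"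
  assumes "positive_stable B"
  shows "(\<lambda>n. (1 / fact n) *\<^sub>R (mpochhammer A n ** matrix_inv (mpochhammer B n) ** mpow W n)) sums hyp1F1 A B W"
proof -
  obtain K where K: "K \<ge> 0" "\<And>(M::complex^'n^'n) (N::complex^'n^'n). norm (M ** N) \<le> K * norm M * norm N"
    using norm_matrix_mult_le by blast
  let ?N = "norm (mat 1 :: complex^'n^'n)"
  obtain \<alpha> where \<alpha>: "\<alpha> > 0" "\<And>k. norm (mpochhammer A k) \<le> ?N * pochhammer \<alpha> k"
    using norm_mpochhammer_le by blast
  obtain L where L: "L \<ge> 0" "\<And>(M::complex^'n^'n) n. norm (mpow M n) \<le> (L * norm M) ^ n * ?N"
    using norm_mpow_le by blast
  \<comment> \<open>Bounds the growth of the inverse Pochhammer matrix from index k to k +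
    1.\<close>
  define \<beta> where "\<beta> k = K * norm (matrix_inv (B + mat (of_nat k)))" for k
  have \<beta>0: "\<beta> k \<ge> 0" for k using K(1) by (simp add: \<beta>_def)
  have inv: "norm (matrix_inv (mpochhammer B n)) \<le> norm (matrix_inv (mat 1 :: complex^'n^'n)) * (\<Prod>k<n. \<beta> k)" for n
  proof (induction n)
    case (Suc n)
    have "matrix_inv (mpochhammer B (Suc n)) = matrix_inv (B + mat (of_nat n)) ** matrix_inv (mpochhammer B n)"
      unfolding mpochhammer.simps
      by (intro matrix_inv_mult invertible_mpochhammer positive_stable_invertible positive_stable_add_nat assms)
    then have "norm (matrix_inv (mpochhammer B (Suc n))) \<le> \<beta> n * norm (matrix_inv (mpochhammer B n))"
      using K(2) by (simp add: \<beta>_def)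
    also have "\<dots> \<le> \<beta> n * (norm (matrix_inv (mat 1 :: complex^'n^'n)) * (\<Prod>k<n. \<beta> k))"
      by (intro mult_left_mono Suc \<beta>0)
    finally show ?case by (simp add: mult_ac)
  qed simp
  define \<omega> where "\<omega> = L * norm W"
  have "\<omega> \<ge> 0" using L(1) by (simp add: \<omega>_def)
  define s where "s n = pochhammer \<alpha> n * (\<Prod>k<n. \<beta> k) * \<omega> ^ n / fact n" for n
  have s0: "s n \<ge> 0" for n
    using \<alpha>(1) \<beta>0 \<open>\<omega> \<ge> 0\<close> by (auto simp: s_def intro!: divide_nonneg_pos mult_nonneg_nonneg pochhammer_nonneg prod_nonneg)
  have "summable s"
  proof -
    have "\<beta> \<longlonglongrightarrow> K * 0"
      unfolding \<beta>_def by (intro tendsto_intros norm_matrix_inv_add_nat_tendsto_0 assms)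
    then have "(\<lambda>k. (\<alpha> + 1) * \<omega> * \<beta> k) \<longlonglongrightarrow> (\<alpha> + 1) * \<omega> * (K * 0)" by (intro tendsto_intros)
    then have "\<forall>\<^sub>F k in sequentially. (\<alpha> + 1) * \<omega> * \<beta> k < 1 / 2"
      by (intro order_tendstoD(2)[of _ "(\<alpha> + 1) * \<omega> * (K * 0)"]) auto
    then obtain n0 where n0: "\<And>k. k \<ge> n0 \<Longrightarrow> (\<alpha> + 1) * \<omega> * \<beta> k < 1 / 2"
      by (auto simp: eventually_sequentially)
    show ?thesis
    proof (rule summable_ratio_test[of "1 / 2" n0])
      fix n assume "n \<ge> n0"
      have "s (Suc n) = s n * ((\<alpha> + real n) / (real n + 1) * \<omega> * \<beta> n)"
        by (simp add: s_def pochhammer_Suc add_ac mult_ac)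
      also have "\<dots> \<le> s n * ((\<alpha> + 1) * \<omega> * \<beta> n)"
        using \<alpha>(1) \<beta>0 \<open>\<omega> \<ge> 0\<close> s0
        by (intro mult_left_mono mult_right_mono) (auto simp: field_simps)
      also have "\<dots> \<le> s n * (1 / 2)" using n0[OF \<open>n \<ge> n0\<close>] s0 by (intro mult_left_mono) auto
      finally show "norm (s (Suc n)) \<le> 1 / 2 * norm (s n)" using s0 by simp
    qed simp
  qed
  let ?c = "\<lambda>n. (1 / fact n) *\<^sub>R (mpochhammer A n ** matrix_inv (mpochhammer B n) ** mpow W n)"
  let ?D = "K * K * ?N * norm (matrix_inv (mat 1 :: complex^'n^'n)) * ?N"
  have "norm (?c n) \<le> ?D * s n" for n
  proof -
    have "norm (mpochhammer A n ** matrix_inv (mpochhammer B n) ** mpow W n)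
        \<le> K * (K * norm (mpochhammer A n) * norm (matrix_inv (mpochhammer B n))) * norm (mpow W n)"
      using K by (intro order_trans[OF K(2)] mult_right_mono mult_left_mono) auto
    also have "\<dots> \<le> K * (K * (?N * pochhammer \<alpha> n) * (norm (matrix_inv (mat 1 :: complex^'n^'n)) * (\<Prod>k<n. \<beta> k))) * (\<omega> ^ n * ?N)"
      unfolding \<omega>_def using K(1) \<alpha> L(1) \<beta>0
      by (intro mult_mono inv L(2) \<alpha>(2)) (auto intro!: mult_nonneg_nonneg pochhammer_nonneg prod_nonneg)
    finally have "norm (mpochhammer A n ** matrix_inv (mpochhammer B n) ** mpow W n) / fact n
       \<le> K * (K * (?N * pochhammer \<alpha> n) * (norm (matrix_inv (mat 1 :: complex^'n^'n)) * (\<Prod>k<n. \<beta> k))) * (\<omega> ^ n * ?N) / fact n"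
      by (rule divide_right_mono) simp
    then show ?thesis by (simp add: s_def mult_ac)
  qed
  then have "summable (\<lambda>n. norm (?c n))"
    by (intro summable_comparison_test'[OF summable_mult[OF \<open>summable s\<close>], where N = 0]) auto
  then show ?thesis unfolding hyp1F1_def by (rule summable_sums[OF summable_norm_cancel])
qed

lemma commute_hyp1F1:
  fixes A B W X :: "complex^'n^'n"
  assumes "positive_stable B" "X ** A = A ** X" "X ** B = B ** X" "X ** W = W ** X"
  shows "X ** hyp1F1 A B W = hyp1F1 A B W ** X"
proof -
  let ?c = "\<lambda>n. (1 / fact n) *\<^sub>R (mpochhammer A n ** matrix_inv (mpochhammer B n) ** mpow W n)"
  have "X ** ?c n = ?c n ** X" for n
  proof -
    have "X ** matrix_inv (mpochhammer B n) = matrix_inv (mpochhammer B n) ** X"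
      by (rule matrix_inv_commute[symmetric]) (simp_all add: invertible_mpochhammer assms(1,3) commute_mpochhammer)
    then have "X ** (mpochhammer A n ** matrix_inv (mpochhammer B n) ** mpow W n)
        = mpochhammer A n ** matrix_inv (mpochhammer B n) ** mpow W n ** X"
      by (intro matrix_mult_commute commute_mpochhammer commute_mpow assms(2,4))
    then show ?thesis by (simp add: mm.scaleR_left mm.scaleR_right)
  qed
  moreover have "(\<lambda>n. X ** ?c n) sums (X ** hyp1F1 A B W)"
    by (intro bounded_linear.sums[OF mm.bounded_linear_right] hyp1F1_sums assms(1))
  moreover have "(\<lambda>n. ?c n ** X) sums (hyp1F1 A B W ** X)"
    by (intro bounded_linear.sums[OF mm.bounded_linear_left] hyp1F1_sums assms(1))
  ultimately show ?thesis by (simp add: sums_unique2)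
qed

lemma commute_ext_mBeta:
  fixes A B Y P Q X :: "complex^'n^'n"
  assumes "positive_stable B" "X ** A = A ** X" "X ** B = B ** X" "X ** Y = Y ** X"
    "X ** P = P ** X" "X ** Q = Q ** X"
  shows "X ** ext_mBeta A B Y P Q = ext_mBeta A B Y P Q ** X"
  unfolding ext_mBeta_def
proof (intro commute_integral matrix_mult_commute commute_hyp1F1 commute_rpow commute_diff_mat assms)
  show "X ** - ((1 / (t * (1 - t))) *\<^sub>R Y) = - ((1 / (t * (1 - t))) *\<^sub>R Y) ** X" for t
    using assms(4) by (simp add: mm.minus_left mm.minus_right mm.scaleR_left mm.scaleR_right)
qed

text \<open>Integrability may be merely conditional, so t^m \<le> 1 alone gives no bound. The
  indefinite integral, continuous on a compact interval, supplies one bound \<open>M\<close> for all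
  partial integrals starting at 0.\<close>

lemma power_weighted_integral_bounded_real:
  fixes f :: "real \<Rightarrow> real"
  assumes f: "f integrable_on {0..1}"
  shows "\<exists>C. \<forall>m. (\<lambda>t. t ^ m * f t) integrable_on {0..1} \<and> \<bar>integral {0..1} (\<lambda>t. t ^ m * f t)\<bar> \<le> C"
proof -
  define I where "I c = integral {0..c} f" for c
  have "continuous_on {0..1} I" unfolding I_def by (rule indefinite_integral_continuous_1[OF f])
  then have "bounded (I ` {0..1})" by (intro compact_imp_bounded compact_continuous_image) auto
  then obtain M where "\<forall>c\<in>{0..1}. \<bar>I c\<bar> \<le> M" by (auto simp: bounded_iff)
  then have M: "\<And>c. 0 \<le> c \<Longrightarrow> c \<le> 1 \<Longrightarrow> \<bar>I c\<bar> \<le> M" by simp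
  have "(\<lambda>t. t ^ m * f t) integrable_on {0..1} \<and> \<bar>integral {0..1} (\<lambda>t. t ^ m * f t)\<bar> \<le> M + (M + M)" for m :: nat
  proof -
    obtain c where c: "c \<in> {0..1}"
      "((\<lambda>t. t ^ m * f t) has_integral (0 ^ m * integral {0..c} f + 1 ^ m * integral {c..1} f)) {0..1}"
      using second_mean_value_theorem_full[OF f, of "\<lambda>t. t ^ m"] by (auto simp: power_mono)
    have "I c + integral {c..1} f = I 1"
      unfolding I_def using c(1) f by (intro Henstock_Kurzweil_Integration.integral_combine) auto
    moreover have "\<bar>I c\<bar> \<le> M" "\<bar>I 1\<bar> \<le> M" using c(1) by (auto intro: M)
    \<comment> \<open>For m = 0 the power \<open>0 ^ m\<close> is 1, so this term does not
      vanish.\<close>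
    moreover have "\<bar>0 ^ m * I c\<bar> \<le> M" using \<open>\<bar>I c\<bar> \<le> M\<close> by (cases m) auto
    ultimately have "\<bar>0 ^ m * I c + integral {c..1} f\<bar> \<le> M + (M + M)" by linarith
    with c(2) show ?thesis by (auto simp: I_def integral_unique has_integral_integrable)
  qed
  then show ?thesis by blast
qed

lemma power_weighted_integral_bounded_integrable:
  fixes f :: "real \<Rightarrow> 'a::euclidean_space"
  assumes "f integrable_on {0..1}"
  shows "\<exists>C. \<forall>m. (\<lambda>t. t ^ m *\<^sub>R f t) integrable_on {0..1} \<and> norm (integral {0..1} (\<lambda>t. t ^ m *\<^sub>R f t)) \<le> C"
proof -
  have "\<forall>b\<in>Basis. \<exists>C. \<forall>m. (\<lambda>t. t ^ m * (f t \<bullet> b)) integrable_on {0..1} \<and>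
      \<bar>integral {0..1} (\<lambda>t. t ^ m * (f t \<bullet> b))\<bar> \<le> C"
  proof
    fix b :: 'a assume "b \<in> Basis"
    then have "(\<lambda>t. f t \<bullet> b) integrable_on {0..1}" using assms integrable_componentwise_iff by blast
    then show "\<exists>C. \<forall>m. (\<lambda>t. t ^ m * (f t \<bullet> b)) integrable_on {0..1} \<and>
        \<bar>integral {0..1} (\<lambda>t. t ^ m * (f t \<bullet> b))\<bar> \<le> C"
      by (rule power_weighted_integral_bounded_real)
  qed
  from bchoice[OF this] obtain C where C':
    "\<forall>b\<in>Basis. \<forall>m. (\<lambda>t. t ^ m * (f t \<bullet> b)) integrable_on {0..1} \<and>
      \<bar>integral {0..1} (\<lambda>t. t ^ m * (f t \<bullet> b))\<bar> \<le> C b" by blast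
  then have C: "\<And>b m. b \<in> Basis \<Longrightarrow> (\<lambda>t. t ^ m * (f t \<bullet> b)) integrable_on {0..1}"
    "\<And>b m. b \<in> Basis \<Longrightarrow> \<bar>integral {0..1} (\<lambda>t. t ^ m * (f t \<bullet> b))\<bar> \<le> C b"
    by simp_all
  have int: "(\<lambda>t. t ^ m *\<^sub>R f t) integrable_on {0..1}" for m
    using C(1) by (subst integrable_componentwise_iff) simp
  have "norm (integral {0..1} (\<lambda>t. t ^ m *\<^sub>R f t)) \<le> (\<Sum>b\<in>Basis. C b)" for m
  proof -
    have "norm (integral {0..1} (\<lambda>t. t ^ m *\<^sub>R f t)) \<le> (\<Sum>b\<in>Basis. \<bar>integral {0..1} (\<lambda>t. t ^ m *\<^sub>R f t) \<bullet> b\<bar>)"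
      by (rule norm_le_l1)
    also have "\<dots> \<le> (\<Sum>b\<in>Basis. C b)"
      using C(2) by (intro sum_mono) (simp add: integral_component_eq[OF int, symmetric])
    finally show ?thesis .
  qed
  with int show ?thesis by blast
qed

text \<open>
  The weights \<open>t ^ m\<close> are monotone, so the second mean value theorem expresses the weighted integrals
  by partial integrals of \<open>f\<close>. Below the first \<open>m\<close> for which the integral exists its value is the
  default \<open>0\<close>, so no integrability assumption is required.
\<close>

lemma power_weighted_integral_bounded:
  fixes f :: "real \<Rightarrow> 'a::euclidean_space"
  shows "\<exists>C. \<forall>m. norm (integral {0<..<1} (\<lambda>t. t ^ m *\<^sub>R f t)) \<le> C"
proof (cases "\<exists>k. (\<lambda>t. t ^ k *\<^sub>R f t) integrable_on {0..1}")
  case True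
  then obtain k where "(\<lambda>t. t ^ k *\<^sub>R f t) integrable_on {0..1}" by blast
  from power_weighted_integral_bounded_integrable[OF this] obtain C
    where C: "\<And>m. norm (integral {0..1} (\<lambda>t. t ^ m *\<^sub>R (t ^ k *\<^sub>R f t))) \<le> C" by blast
  have "C \<ge> 0" using order_trans[OF norm_ge_zero C[of 0]] .
  let ?n = "\<lambda>m. norm (integral {0<..<1} (\<lambda>t. t ^ m *\<^sub>R f t))"
  \<comment> \<open>\<open>k\<close> need not be the least exponent with integrability; the finitely
    many smaller ones are covered by their sum.\<close>
  have "?n m \<le> C + (\<Sum>m<k. ?n m)" for m
  proof (cases "m < k")
    case True
    then have "?n m \<le> (\<Sum>m<k. ?n m)" by (intro member_le_sum) auto
    with \<open>C \<ge> 0\<close> show ?thesis by linarith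
  next
    case False
    then have "?n m \<le> C" using C[of "m - k"] by (simp add: integral_open_interval_real flip: power_add)
    moreover have "0 \<le> (\<Sum>m<k. ?n m)" by (intro sum_nonneg) auto
    ultimately show ?thesis by linarith
  qed
  then show ?thesis by blast
next
  case False
  then show ?thesis
    by (intro exI[of _ 0]) (simp add: not_integrable_integral flip: integral_open_interval_real)
qed

text \<open>Raising \<open>P\<close> by mI multiplies the integrand by the scalar t^m.\<close>

lemma ext_mBeta_bounded:
  fixes A B Y P Q :: "complex^'n^'n"
  shows "\<exists>C. \<forall>m. norm (ext_mBeta A B Y (P + mat (of_nat m)) Q) \<le> C"
proof -
  let ?f = "\<lambda>t. hyp1F1 A B (- ((1 / (t * (1 - t))) *\<^sub>R Y)) ** rpow t (P - mat 1) ** rpow (1 - t) (Q - mat 1)"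
  have "ext_mBeta A B Y (P + mat (of_nat m)) Q = integral {0<..<1} (\<lambda>t. t ^ m *\<^sub>R ?f t)" for m
    unfolding ext_mBeta_def
  proof (rule integral_cong)
    fix t :: real assume t: "t \<in> {0<..<1}"
    have "P + mat (of_nat m) - mat 1 = (P - mat 1) + mat (of_real (real m))" by simp
    then have "rpow t (P + mat (of_nat m) - mat 1) = t ^ m *\<^sub>R rpow t (P - mat 1)"
      using t by (simp only: rpow_add_mat greaterThanLessThan_iff) (simp add: powr_realpow)
    then show "hyp1F1 A B (- ((1 / (t * (1 - t))) *\<^sub>R Y)) ** rpow t (P + mat (of_nat m) - mat 1) ** rpow (1 - t) (Q - mat 1)
        = t ^ m *\<^sub>R ?f t"
      by (simp add: mm.scaleR_left mm.scaleR_right)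
  qed
  then show ?thesis using power_weighted_integral_bounded[of ?f] by simp
qed

section \<open>Double power series with matrix coefficients\<close>

text \<open>A growth class adapted to Appell coefficients: it is stable under shifts of either
  index, hence under termwise differentiation, and its majorant is the double expansion of (1 - x -
  y)^(-\<alpha>).\<close>

definition pochhammer_bounded :: "(nat \<Rightarrow> nat \<Rightarrow> 'a::real_normed_vector) \<Rightarrow> bool" where
  "pochhammer_bounded a \<longleftrightarrow> (\<exists>C \<alpha>. \<alpha> > 0 \<and> (\<forall>p q. norm (a p q) \<le> C * pochhammer \<alpha> (p + q)))"

lemma pochhammer_bounded_Suc:
  assumes "pochhammer_bounded a"
  shows "pochhammer_bounded (\<lambda>p q. a (Suc p) q)"
proof -
  obtain C \<alpha> where C: "\<alpha> > 0" "\<And>p q. norm (a p q) \<le> C * pochhammer \<alpha> (p + q)"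
    using assms unfolding pochhammer_bounded_def by blast
  \<comment> \<open>From (\<alpha>)_(k+1) = \<alpha> (\<alpha> + 1)_k: a shift raises the parameter
    by 1.\<close>
  have "norm (a (Suc p) q) \<le> (C * \<alpha>) * pochhammer (\<alpha> + 1) (p + q)" for p q
    using C(2)[of "Suc p" q] by (simp add: pochhammer_rec mult_ac)
  with C(1) show ?thesis unfolding pochhammer_bounded_def by (intro exI[of _ "C * \<alpha>"] exI[of _ "\<alpha> + 1"]) auto
qed

lemma pochhammer_bounded_swap:
  "pochhammer_bounded a \<Longrightarrow> pochhammer_bounded (\<lambda>p q. a q p)"
  unfolding pochhammer_bounded_def by (metis add.commute)

lemma pochhammer_bounded_shift:
  assumes "pochhammer_bounded a"
  shows "pochhammer_bounded (\<lambda>p q. a (p + k) q)"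
proof (induction k)
  case (Suc k)
  from pochhammer_bounded_Suc[OF this] show ?case by simp
qed (simp add: assms)

lemma pochhammer_bounded_nth:
  fixes a :: "nat \<Rightarrow> nat \<Rightarrow> complex^'n^'n"
  assumes "pochhammer_bounded a"
  shows "pochhammer_bounded (\<lambda>p q. a p q $ i $ j)"
proof -
  have "cmod (M $ i $ j) \<le> norm M" for M :: "complex^'n^'n"
    by (rule order_trans[OF Finite_Cartesian_Product.norm_nth_le Finite_Cartesian_Product.norm_nth_le])
  then show ?thesis using assms unfolding pochhammer_bounded_def by (meson order_trans)
qed

text \<open>Collecting the terms with p + q = k by the binomial theorem gives (\<alpha>)_k (x + y)^k
  / k!, the binomial series of exponent -\<alpha> at -(x + y). Its sum bounds all finite partial
  sums.\<close>

lemma summable_on_pochhammer: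
  fixes \<alpha> x y :: real
  assumes "\<alpha> > 0" "x \<ge> 0" "y \<ge> 0" "x + y < 1"
  shows "(\<lambda>(p, q). pochhammer \<alpha> (p + q) * (x ^ p * y ^ q / (fact p * fact q))) summable_on UNIV"
proof (rule nonneg_bdd_above_summable_on)
  let ?f = "\<lambda>(p, q). pochhammer \<alpha> (p + q) * (x ^ p * y ^ q / (fact p * fact q))"
  have nonneg: "?f r \<ge> 0" for r using assms
    by (auto simp: split_def intro!: mult_nonneg_nonneg divide_nonneg_nonneg pochhammer_nonneg)
  then show "\<And>r. r \<in> UNIV \<Longrightarrow> 0 \<le> ?f r" .
  have sm: "summable (\<lambda>k. pochhammer \<alpha> k / fact k * (x + y) ^ k)"
  proof -
    have "\<bar>- (x + y)\<bar> < 1" using assms by simp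
    from gen_binomial_real[OF this, of "- \<alpha>"]
    have "summable (\<lambda>k. (- \<alpha> gchoose k) * (- (x + y)) ^ k)" by (rule sums_summable)
    moreover have "(- \<alpha> gchoose k) * (- (x + y)) ^ k = pochhammer \<alpha> k / fact k * (x + y) ^ k" for k
      by (simp add: gbinomial_pochhammer power_minus[of "x + y"] add.commute[of y x] flip: power_mult_distrib)
    ultimately show ?thesis by simp
  qed
  have nonneg': "0 \<le> pochhammer \<alpha> k / fact k * (x + y) ^ k" for k
    using assms by (auto intro!: mult_nonneg_nonneg divide_nonneg_nonneg pochhammer_nonneg)
  show "bdd_above (sum ?f ` {F. F \<subseteq> UNIV \<and> finite F})"
  proof (rule bdd_aboveI2)
    fix F :: "(nat \<times> nat) set" assume "F \<in> {F. F \<subseteq> UNIV \<and> finite F}"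
    then have "finite F" by simp
    \<comment> \<open>Any bound on p + q over \<open>F\<close> would do; it encloses
      \<open>F\<close> in a triangle that can be summed by diagonals.\<close>
    define N where "N = (\<Sum>(p, q)\<in>F. p + q)"
    have sub: "F \<subseteq> {(p, q). p + q \<le> N}"
    proof
      fix r assume "r \<in> F"
      then have "(\<lambda>(p, q). p + q) r \<le> N"
        unfolding N_def using \<open>finite F\<close> by (intro member_le_sum) auto
      then show "r \<in> {(p, q). p + q \<le> N}" by auto
    qed
    have fin: "finite {(p, q). p + q \<le> N}"
      by (rule finite_subset[of _ "{..N} \<times> {..N}"]) auto
    have "sum ?f F \<le> sum ?f {(p, q). p + q \<le> N}"
      by (intro sum_mono2 fin sub nonneg)
    also have "\<dots> = (\<Sum>k\<le>N. \<Sum>p\<le>k. pochhammer \<alpha> k * (x ^ p * y ^ (k - p) / (fact p * fact (k - p))))"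
      using sum.triangle_reindex_eq[of "\<lambda>p q. pochhammer \<alpha> (p + q) * (x ^ p * y ^ q / (fact p * fact q))" N]
      by simp
    also have "\<dots> = (\<Sum>k\<le>N. pochhammer \<alpha> k / fact k * (x + y) ^ k)"
      by (intro sum.cong refl)
         (auto simp: binomial_ring sum_distrib_left binomial_fact field_simps intro!: sum.cong)
    also have "\<dots> \<le> (\<Sum>k. pochhammer \<alpha> k / fact k * (x + y) ^ k)"
      by (rule sum_le_suminf[OF sm]) (use nonneg' in auto)
    finally show "sum ?f F \<le> (\<Sum>k. pochhammer \<alpha> k / fact k * (x + y) ^ k)" .
  qed
qed

text \<open>Only the norm of \<open>f\<close> is prescribed, so that scalar and matrix series are
  covered at once.\<close>

lemma double_series_summable:
  fixes a :: "nat \<Rightarrow> nat \<Rightarrow> 'a::real_normed_vector" and f :: "nat \<Rightarrow> nat \<Rightarrow> 'b::banach" and z w :: complex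
  assumes "pochhammer_bounded a" "cmod z + cmod w < 1"
    and "\<And>p q. norm (f p q) = norm (a p q) * cmod (z ^ p * w ^ q / (fact p * fact q))"
  shows "(\<lambda>(p, q). f p q) summable_on (UNIV :: (nat \<times> nat) set)"
proof -
  obtain C \<alpha> where C: "\<alpha> > 0" "\<And>p q. norm (a p q) \<le> C * pochhammer \<alpha> (p + q)"
    using assms(1) unfolding pochhammer_bounded_def by blast
  have "(\<lambda>(p, q). pochhammer \<alpha> (p + q) * (cmod z ^ p * cmod w ^ q / (fact p * fact q))) summable_on UNIV"
    using assms(2) C(1) by (intro summable_on_pochhammer) auto
  then have "(\<lambda>r. C * (\<lambda>(p, q). pochhammer \<alpha> (p + q) * (cmod z ^ p * cmod w ^ q / (fact p * fact q))) r) summable_on UNIV"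
    by (rule summable_on_cmult_right)
  then have "(\<lambda>r. norm ((\<lambda>(p, q). f p q) r)) summable_on UNIV"
  proof (rule summable_on_comparison_test)
    fix r :: "nat \<times> nat"
    obtain p q where r: "r = (p, q)" by (cases r)
    have "norm (a p q) * cmod (z ^ p * w ^ q / (fact p * fact q))
        \<le> C * pochhammer \<alpha> (p + q) * cmod (z ^ p * w ^ q / (fact p * fact q))"
      by (intro mult_right_mono C(2)) auto
    then show "norm ((\<lambda>(p, q). f p q) r) \<le> C * (\<lambda>(p, q). pochhammer \<alpha> (p + q) * (cmod z ^ p * cmod w ^ q / (fact p * fact q))) r"
      by (simp add: r assms(3) norm_mult norm_divide norm_power mult_ac)
  qed auto
  then show ?thesis by (rule abs_summable_summable[of "\<lambda>(p, q). f p q"])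
qed

section \<open>Reduction to power series in one variable\<close>

lemma scalar_double_series_sums:
  fixes c :: "nat \<Rightarrow> nat \<Rightarrow> complex"
  assumes "pochhammer_bounded c" "cmod z + cmod w < 1"
  shows "(\<lambda>p. (\<Sum>\<^sub>\<infinity>q. c p q * (w ^ q / fact q)) / fact p * z ^ p) sums
    (\<Sum>\<^sub>\<infinity>(p, q)\<in>UNIV. c p q * (z ^ p * w ^ q / (fact p * fact q)))"
proof -
  let ?f = "\<lambda>p q. c p q * (z ^ p * w ^ q / (fact p * fact q))"
  have "(\<lambda>(p, q). ?f p q) summable_on UNIV"
    by (rule double_series_summable[OF assms]) (rule norm_mult)
  then have sm: "(\<lambda>(p, q). ?f p q) summable_on Sigma UNIV (\<lambda>_. UNIV)" by simp
  have inner: "(\<Sum>\<^sub>\<infinity>q. ?f p q) = (\<Sum>\<^sub>\<infinity>q. c p q * (w ^ q / fact q)) / fact p * z ^ p" for p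
  proof -
    have "(\<Sum>\<^sub>\<infinity>q. ?f p q) = (\<Sum>\<^sub>\<infinity>q. (z ^ p / fact p) * (c p q * (w ^ q / fact q)))"
      by (simp add: field_simps)
    also have "\<dots> = (z ^ p / fact p) * (\<Sum>\<^sub>\<infinity>q. c p q * (w ^ q / fact q))" by (rule infsum_cmult_right')
    finally show ?thesis by simp
  qed
  have "((\<lambda>p. \<Sum>\<^sub>\<infinity>q. ?f p q) has_sum (\<Sum>\<^sub>\<infinity>p. \<Sum>\<^sub>\<infinity>q. ?f p q)) UNIV"
    using summable_on_Sigma_banach[OF sm] by (rule has_sum_infsum)
  from has_sum_imp_sums[OF this]
  have "(\<lambda>p. \<Sum>\<^sub>\<infinity>q. ?f p q) sums (\<Sum>\<^sub>\<infinity>(p, q)\<in>Sigma UNIV (\<lambda>_. UNIV). ?f p q)"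
    unfolding infsum_Sigma'_banach[OF sm] .
  then show ?thesis unfolding inner by simp
qed

text \<open>For fixed w, summing over q first leaves an ordinary power series in z that converges
  for |z| < 1 - |w|; its derivative is obtained termwise.\<close>

lemma scalar_double_series_derivative:
  fixes c :: "nat \<Rightarrow> nat \<Rightarrow> complex"
  assumes "pochhammer_bounded c" "cmod z + cmod w < 1"
  shows "((\<lambda>u. \<Sum>\<^sub>\<infinity>(p, q)\<in>UNIV. c p q * (u ^ p * w ^ q / (fact p * fact q))) has_field_derivative
    (\<Sum>\<^sub>\<infinity>(p, q)\<in>UNIV. c (Suc p) q * (z ^ p * w ^ q / (fact p * fact q)))) (at z)"
proof -
  define b where "b p = (\<Sum>\<^sub>\<infinity>q. c p q * (w ^ q / fact q)) / fact p" for p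
  have sums: "(\<lambda>p. b p * u ^ p) sums (\<Sum>\<^sub>\<infinity>(p, q)\<in>UNIV. c p q * (u ^ p * w ^ q / (fact p * fact q)))"
    if "cmod u < 1 - cmod w" for u
    unfolding b_def using that by (intro scalar_double_series_sums assms) auto
  have "diffs b p = (\<Sum>\<^sub>\<infinity>q. c (Suc p) q * (w ^ q / fact q)) / fact p" for p
    by (simp add: diffs_def b_def del: of_nat_Suc)
  then have "(\<lambda>p. diffs b p * z ^ p) sums (\<Sum>\<^sub>\<infinity>(p, q)\<in>UNIV. c (Suc p) q * (z ^ p * w ^ q / (fact p * fact q)))"
    using scalar_double_series_sums[OF pochhammer_bounded_Suc[OF assms(1)] assms(2)] by simp
  moreover have "((\<lambda>u. \<Sum>p. b p * u ^ p) has_field_derivative (\<Sum>p. diffs b p * z ^ p)) (at z)"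
    by (rule termdiffs_strong'[where K = "1 - cmod w"]) (use sums assms(2) in \<open>auto intro: sums_summable\<close>)
  ultimately have "((\<lambda>u. \<Sum>p. b p * u ^ p) has_field_derivative
      (\<Sum>\<^sub>\<infinity>(p, q)\<in>UNIV. c (Suc p) q * (z ^ p * w ^ q / (fact p * fact q)))) (at z)"
    by (simp add: sums_iff)
  then show ?thesis
  proof (rule has_field_derivative_transform_within_open[where S = "ball 0 (1 - cmod w)"])
    show "z \<in> ball 0 (1 - cmod w)" using assms(2) by simp
  qed (use sums in \<open>auto simp: sums_iff\<close>)
qed

text \<open>With the factorials kept in the weight, differentiation becomes a pure shift of the
  coefficient indices.\<close>

definition double_series :: "(nat \<Rightarrow> nat \<Rightarrow> complex^'n^'n) \<Rightarrow> complex \<Rightarrow> complex \<Rightarrow> complex^'n^'n" where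
  "double_series a z w = (\<Sum>\<^sub>\<infinity>(p, q)\<in>UNIV. a p q ** mat (z ^ p * w ^ q / (fact p * fact q)))"

lemma double_series_summable_on:
  fixes a :: "nat \<Rightarrow> nat \<Rightarrow> complex^'n^'n"
  assumes "pochhammer_bounded a" "cmod z + cmod w < 1"
  shows "(\<lambda>(p, q). a p q ** mat (z ^ p * w ^ q / (fact p * fact q))) summable_on UNIV"
  by (rule double_series_summable[OF assms]) (simp add: mat_commute[of "a _ _"] norm_mat_mult)

text \<open>The second premise expresses complex linearity; the result serves to move constant
  matrix factors on both sides into the sum.\<close>

lemma double_series_linear:
  assumes "bounded_linear h" "\<And>M c. h (M ** mat c) = h M ** mat c"
    and "pochhammer_bounded a" "cmod z + cmod w < 1"
  shows "h (double_series a z w) = double_series (\<lambda>p q. h (a p q)) z w"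
  using infsumI[OF has_sum_bounded_linear[OF assms(1) has_sum_infsum[OF double_series_summable_on[OF assms(3,4)]]]]
  by (simp add: double_series_def case_prod_unfold assms(2))

lemma double_series_nth:
  assumes "pochhammer_bounded a" "cmod z + cmod w < 1"
  shows "double_series a z w $ i $ j = (\<Sum>\<^sub>\<infinity>(p, q)\<in>UNIV. a p q $ i $ j * (z ^ p * w ^ q / (fact p * fact q)))"
  using infsumI[OF has_sum_bounded_linear[OF bounded_linear_nth_nth[of i j]
      has_sum_infsum[OF double_series_summable_on[OF assms]]]]
  by (simp add: double_series_def case_prod_unfold mult_mat_nth)

text \<open>Reduces derivatives in the second variable to those in the first.\<close>

lemma double_series_swap: "double_series a z w = double_series (\<lambda>p q. a q p) w z"
proof -
  have "double_series a z w = (\<Sum>\<^sub>\<infinity>r\<in>UNIV. (\<lambda>(p, q). a p q ** mat (z ^ p * w ^ q / (fact p * fact q))) (prod.swap r))"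
    unfolding double_series_def by (rule infsum_reindex_bij_betw[OF bij_swap, symmetric])
  then show ?thesis by (simp add: double_series_def case_prod_unfold mult.commute)
qed

lemma double_series_has_derivative:
  assumes "pochhammer_bounded a" "cmod z + cmod w < 1"
  shows "((\<lambda>u. double_series a u w) has_derivative (\<lambda>h. mat h ** double_series (\<lambda>p q. a (Suc p) q) z w)) (at z)"
proof (rule has_derivative_vecI, rule has_derivative_vecI)
  fix i j
  have "(\<lambda>h. (mat h ** double_series (\<lambda>p q. a (Suc p) q) z w) $ i $ j) =
      (*) (\<Sum>\<^sub>\<infinity>(p, q)\<in>UNIV. a (Suc p) q $ i $ j * (z ^ p * w ^ q / (fact p * fact q)))"
    unfolding mat_mult_nth double_series_nth[OF pochhammer_bounded_Suc[OF assms(1)] assms(2)]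
    by (simp add: fun_eq_iff mult.commute)
  then have "((\<lambda>u. \<Sum>\<^sub>\<infinity>(p, q)\<in>UNIV. a p q $ i $ j * (u ^ p * w ^ q / (fact p * fact q))) has_derivative
    (\<lambda>h. (mat h ** double_series (\<lambda>p q. a (Suc p) q) z w) $ i $ j)) (at z)"
    using scalar_double_series_derivative[OF pochhammer_bounded_nth[OF assms(1), of i j] assms(2)]
    by (simp only: has_field_derivative_def)
  then show "((\<lambda>u. double_series a u w $ i $ j) has_derivative
    (\<lambda>h. (mat h ** double_series (\<lambda>p q. a (Suc p) q) z w) $ i $ j)) (at z)"
  proof (rule has_derivative_transform_within_open[where s = "ball 0 (1 - cmod w)"])
    show "z \<in> ball 0 (1 - cmod w)" using assms(2) by simp
  qed (auto simp: double_series_nth[OF assms(1)])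
qed

lemma double_series_has_nth_derivative:
  assumes "pochhammer_bounded a" "cmod z + cmod w < 1"
  shows "has_nth_derivative k (\<lambda>u. double_series a u w) (double_series (\<lambda>p q. a (p + k) q) z w) z"
  using assms
proof (induction k arbitrary: a)
  case (Suc k)
  let ?g = "\<lambda>u. double_series (\<lambda>p q. a (Suc p) q) u w"
  \<comment> \<open>\<open>has_nth_derivative\<close> asks for the derivative on a neighbourhood;
    this ball stays inside the domain of convergence.\<close>
  have "\<forall>\<^sub>F u in nhds z. u \<in> ball 0 (1 - cmod w)"
    using Suc.prems(2) by (intro eventually_nhds_in_open) auto
  then have "\<forall>\<^sub>F u in nhds z. ((\<lambda>u. double_series a u w) has_derivative (\<lambda>h. mat h ** ?g u)) (at u)"
    by (rule eventually_mono) (auto intro!: double_series_has_derivative Suc.prems(1))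
  moreover have "has_nth_derivative k ?g (double_series (\<lambda>p q. a (p + Suc k) q) z w) z"
    using Suc.IH[OF pochhammer_bounded_Suc[OF Suc.prems(1)] Suc.prems(2)] by simp
  ultimately show ?case by auto
qed simp

lemma double_series_has_mixed_derivative:
  assumes "pochhammer_bounded a" "cmod z + cmod w < 1"
  shows "has_mixed_derivative m n (double_series a) (double_series (\<lambda>p q. a (p + m) (q + n)) z w) z w"
  unfolding has_mixed_derivative_def
proof (intro exI conjI)
  have "\<forall>\<^sub>F u in nhds z. u \<in> ball 0 (1 - cmod w)"
    using assms(2) by (intro eventually_nhds_in_open) auto
  then show "\<forall>\<^sub>F u in nhds z. has_nth_derivative n (\<lambda>v. double_series a u v) (double_series (\<lambda>p q. a p (q + n)) u w) w"
  proof (rule eventually_mono)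
    fix u :: complex assume "u \<in> ball 0 (1 - cmod w)"
    then have "cmod w + cmod u < 1" by simp
    from double_series_has_nth_derivative[OF pochhammer_bounded_swap[OF assms(1)] this, of n]
    show "has_nth_derivative n (\<lambda>v. double_series a u v) (double_series (\<lambda>p q. a p (q + n)) u w) w"
      by (simp add: double_series_swap[of _ u])
  qed
  have "pochhammer_bounded (\<lambda>p q. a p (q + n))"
    using pochhammer_bounded_swap[OF pochhammer_bounded_shift[OF pochhammer_bounded_swap[OF assms(1)]]] .
  then show "has_nth_derivative m (\<lambda>u. double_series (\<lambda>p q. a p (q + n)) u w) (double_series (\<lambda>p q. a (p + m) (q + n)) z w) z"
    by (rule double_series_has_nth_derivative[OF _ assms(2)])
qed

section \<open>The extended Appell function\<close>

text \<open>Among the five factors only the Pochhammer matrix can grow with the indices; the others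
  are bounded or constant.\<close>

lemma pochhammer_bounded_Appell:
  fixes M U V :: "complex^'n^'n"
  assumes "\<And>p. norm (E p) \<le> c" "\<And>q. norm (E' q) \<le> c'"
  shows "pochhammer_bounded (\<lambda>p q. mpochhammer M (p + q) ** E p ** U ** E' q ** V)"
proof -
  obtain K where K: "K \<ge> 0" "\<And>(M::complex^'n^'n) (N::complex^'n^'n). norm (M ** N) \<le> K * norm M * norm N"
    using norm_matrix_mult_le by blast
  let ?N = "norm (mat 1 :: complex^'n^'n)"
  obtain \<alpha> where \<alpha>: "\<alpha> > 0" "\<And>k. norm (mpochhammer M k) \<le> ?N * pochhammer \<alpha> k"
    using norm_mpochhammer_le by blast
  have step: "norm (X ** Z) \<le> K * x * y" if "norm X \<le> x" "norm Z \<le> y" for X Z :: "complex^'n^'n" and x y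
  proof -
    have "norm X * norm Z \<le> x * y" using that by (intro mult_mono order_trans[OF norm_ge_zero that(1)]) auto
    with K(1) have "K * (norm X * norm Z) \<le> K * (x * y)" by (rule mult_left_mono[rotated])
    then show ?thesis using K(2)[of X Z] by (simp add: mult.assoc)
  qed
  have "norm (mpochhammer M (p + q) ** E p ** U ** E' q ** V) \<le>
      K * (K * (K * (K * (?N * pochhammer \<alpha> (p + q)) * c) * norm U) * c') * norm V" for p q
    by (intro step \<alpha>(2) assms order_refl)
  then have "norm (mpochhammer M (p + q) ** E p ** U ** E' q ** V) \<le>
      (K ^ 4 * ?N * c * norm U * c' * norm V) * pochhammer \<alpha> (p + q)" for p q
    by (simp add: mult_ac power4_eq_xxxx)
  with \<alpha>(1) show ?thesis unfolding pochhammer_bounded_def by blast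
qed

lemma commute_matrix_inv_mBeta:
  fixes P Q X :: "complex^'n^'n"
  assumes "positive_stable P" "positive_stable Q" "positive_stable (P + Q)"
    and "X ** P = P ** X" "X ** Q = Q ** X"
  shows "X ** matrix_inv (mBeta P Q) = matrix_inv (mBeta P Q) ** X"
proof -
  have "X ** (P + Q) = (P + Q) ** X" using assms by (simp add: mm.add_left mm.add_right)
  then have "X ** matrix_inv (mGamma (P + Q)) = matrix_inv (mGamma (P + Q)) ** X"
    by (intro matrix_inv_commute[symmetric] invertible_mGamma assms commute_mGamma[symmetric])
  then have "X ** mBeta P Q = mBeta P Q ** X"
    unfolding mBeta_def by (intro matrix_mult_commute commute_mGamma assms)
  then show ?thesis by (intro matrix_inv_commute[symmetric] invertible_mBeta assms) simp
qed

text \<open>Each variable brings its own beta quotient, so the inverse factors are (C1)_m^(-1) and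
  (C2)_n^(-1) separately; the conclusion has their product where the informal formula writes
  (C1)^(-1)_(m+n).\<close>

theorem theorem5p5:
  fixes A A' A1 B B' B1 B2 C1 C2 Y :: "complex^'r^'r"
    and z w :: complex and m n :: nat
  assumes "positive_stable A" "positive_stable A'" "positive_stable A1"
    and "positive_stable B" "positive_stable B'"
    and "positive_stable B1" "positive_stable B2"
    and "positive_stable C1" "positive_stable C2"
    and "positive_stable (C1 - B1)" "positive_stable (C2 - B2)"
    and "positive_stable Y"
    and commute: "\<forall>M\<in>{A, A', B, B', B1, B2, C1, C2, Y}. \<forall>N\<in>{A, A', B, B', B1, B2, C1, C2, Y}.
                    M ** N = N ** M"
    and domain: "cmod z + cmod w < 1"
  shows "has_mixed_derivative m n
           (\<lambda>z w. ext_F2 A B A' B' A1 B1 B2 C1 C2 z w Y)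
           (mpochhammer A1 (m + n)
            ** ext_F2 A B A' B' (A1 + mat (of_nat (m + n))) (B1 + mat (of_nat m)) (B2 + mat (of_nat n))
                 (C1 + mat (of_nat m)) (C2 + mat (of_nat n)) z w Y
            ** mpochhammer B1 m ** mpochhammer B2 n
            ** matrix_inv (mpochhammer C1 m) ** matrix_inv (mpochhammer C2 n))
           z w"
proof -
  define E where "E p = ext_mBeta A B Y (B1 + mat (of_nat p)) (C1 - B1)" for p
  define E' where "E' q = ext_mBeta A' B' Y (B2 + mat (of_nat q)) (C2 - B2)" for q
  define U where "U k = matrix_inv (mBeta (B1 + mat (of_nat k)) (C1 - B1))" for k
  define V where "V k = matrix_inv (mBeta (B2 + mat (of_nat k)) (C2 - B2))" for k
  \<comment> \<open>One family for both sides: \<open>coef A1 0 0\<close> is the given series, and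
    base \<open>A1 + mat (of_nat (m + n))\<close> with shifts \<open>m\<close>, \<open>n\<close> is
    the series on the right.\<close>
  define coef where "coef M i j p q = mpochhammer M (p + q) ** E (p + i) ** U i ** E' (q + j) ** V j"
    for M i j p q
  obtain c where c: "\<forall>p. norm (E p) \<le> c"
    unfolding E_def using ext_mBeta_bounded[of A B Y B1 "C1 - B1"] by blast
  obtain c' where c': "\<forall>q. norm (E' q) \<le> c'"
    unfolding E'_def using ext_mBeta_bounded[of A' B' Y B2 "C2 - B2"] by blast
  have bounded: "pochhammer_bounded (coef M i j)" for M i j
    unfolding coef_def by (rule pochhammer_bounded_Appell) (use c c' in auto)
  have F2: "ext_F2 A B A' B' M (B1 + mat (of_nat i)) (B2 + mat (of_nat j)) (C1 + mat (of_nat i)) (C2 + mat (of_nat j)) z w Y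
      = double_series (coef M i j) z w" for M i j z w
  proof -
    have "(C1 + mat (of_nat i)) - (B1 + mat (of_nat i)) = C1 - B1" "(C2 + mat (of_nat j)) - (B2 + mat (of_nat j)) = C2 - B2"
      by simp_all
    then show ?thesis
      by (simp only: ext_F2_def double_series_def coef_def E_def E'_def U_def V_def add.assoc mat_add
          of_nat_add[symmetric] add.commute[of i] add.commute[of j])
  qed
  have mat0: "mat 0 = (0 :: complex^'r^'r)" by (simp add: mat_def vec_eq_iff)
  have F20: "(\<lambda>z w. ext_F2 A B A' B' A1 B1 B2 C1 C2 z w Y) = double_series (coef A1 0 0)"
    using F2[of A1 0 0] by (simp add: fun_eq_iff mat0)
  define pB1 where "pB1 = mpochhammer B1 m"
  define pB2 where "pB2 = mpochhammer B2 n"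
  define iC1 where "iC1 = matrix_inv (mpochhammer C1 m)"
  define iC2 where "iC2 = matrix_inv (mpochhammer C2 n)"
  \<comment> \<open>The constant factors of the right-hand side, gathered as a linear map so that
    they can be distributed over the terms.\<close>
  let ?h = "\<lambda>M. mpochhammer A1 (m + n) ** M ** pB1 ** pB2 ** iC1 ** iC2"
  have h_linear: "bounded_linear ?h"
    by (intro bounded_linear_compose[OF mm.bounded_linear_left] mm.bounded_linear_right)
  have h_mat: "?h (M ** mat a) = ?h M ** mat a" for M a
    by (simp add: mat_commute flip: matrix_mul_assoc) (simp add: mat_commute matrix_mul_assoc)
  \<comment> \<open>The Pochhammer factors in \<open>B1\<close> and \<open>C1\<close> must pass the
    block belonging to the second variable to reach \<open>U m\<close>.\<close>
  have comm_E': "X ** (E' q ** V n) = E' q ** V n ** X"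
    if "X ** A' = A' ** X" "X ** B' = B' ** X" "X ** Y = Y ** X" "X ** B2 = B2 ** X" "X ** C2 = C2 ** X" for X q
  proof -
    have X: "X ** (C2 - B2) = (C2 - B2) ** X" using that by (simp add: mm.diff_left mm.diff_right)
    have "positive_stable (B2 + mat (of_nat n) + (C2 - B2))"
      using positive_stable_add_nat[OF assms(9), of n] by (simp add: algebra_simps)
    with X show ?thesis unfolding E'_def V_def
      by (intro matrix_mult_commute commute_ext_mBeta commute_matrix_inv_mBeta commute_add_mat
          positive_stable_add_nat assms that)
  qed
  have coef_eq: "?h (coef (A1 + mat (of_nat (m + n))) m n p q) = coef A1 0 0 (p + m) (q + n)" for p q
  proof -
    define X where "X = E' (q + n) ** V n"
    have "B1 ** C1 = C1 ** B1" "B2 ** C2 = C2 ** B2" by (rule commute[rule_format]; simp)+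
    note inv_mBeta = this matrix_inv_mBeta_add_nat[of B1 "C1 - B1" m] matrix_inv_mBeta_add_nat[of B2 "C2 - B2" n]
    \<comment> \<open>The shifted beta inverse together with its Pochhammer factors is the unshifted
      one, since B1 + (C1 - B1) = C1.\<close>
    have U: "U m ** pB1 ** iC1 = U 0"
      using inv_mBeta assms(6-11)
      by (simp add: U_def pB1_def iC1_def mat0 mm.diff_left mm.diff_right)
    have V: "V n ** pB2 ** iC2 = V 0"
      using inv_mBeta assms(6-11)
      by (simp add: V_def pB2_def iC2_def mat0 mm.diff_left mm.diff_right)
    have "B1 ** X = X ** B1" "C1 ** X = X ** C1"
      unfolding X_def by (intro comm_E' commute[rule_format]; simp)+
    then have XB: "X ** pB1 = pB1 ** X" and "X ** mpochhammer C1 m = mpochhammer C1 m ** X"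
      unfolding pB1_def by (auto intro!: commute_mpochhammer)
    then have XC: "X ** iC1 = iC1 ** X"
      unfolding iC1_def by (intro matrix_inv_commute[symmetric] invertible_mpochhammer assms) simp
    have "C1 ** B2 = B2 ** C1" by (rule commute[rule_format]) auto
    then have "pB2 ** mpochhammer C1 m = mpochhammer C1 m ** pB2"
      unfolding pB2_def by (intro commute_mpochhammer commute_mpochhammer[symmetric])
    then have BC: "pB2 ** iC1 = iC1 ** pB2"
      unfolding iC1_def by (intro matrix_inv_commute[symmetric] invertible_mpochhammer assms) simp
    \<comment> \<open>Sorting by variable: \<open>pB1\<close> and \<open>iC1\<close> move left
      across \<open>X\<close>, leaving \<open>pB2\<close> and \<open>iC2\<close> next to
      \<open>V n\<close>.\<close>
    have "X ** pB1 ** pB2 ** iC1 ** iC2 = pB1 ** X ** (pB2 ** iC1) ** iC2"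
      unfolding XB by (simp only: matrix_mul_assoc)
    also have "\<dots> = pB1 ** (X ** iC1) ** pB2 ** iC2"
      unfolding BC by (simp only: matrix_mul_assoc)
    finally have "X ** pB1 ** pB2 ** iC1 ** iC2 = pB1 ** iC1 ** X ** pB2 ** iC2"
      unfolding XC by (simp only: matrix_mul_assoc)
    then have "U m ** (X ** pB1 ** pB2 ** iC1 ** iC2) = (U m ** pB1 ** iC1) ** E' (q + n) ** (V n ** pB2 ** iC2)"
      by (simp only: X_def matrix_mul_assoc)
    then have eq: "U m ** X ** pB1 ** pB2 ** iC1 ** iC2 = U 0 ** E' (q + n) ** V 0"
      by (simp only: U V) (simp only: matrix_mul_assoc)
    have "?h (coef (A1 + mat (of_nat (m + n))) m n p q)
        = (mpochhammer A1 (m + n) ** mpochhammer (A1 + mat (of_nat (m + n))) (p + q)) ** E (p + m)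
          ** (U m ** X ** pB1 ** pB2 ** iC1 ** iC2)"
      by (simp add: coef_def X_def matrix_mul_assoc)
    also have "mpochhammer A1 (m + n) ** mpochhammer (A1 + mat (of_nat (m + n))) (p + q)
        = mpochhammer A1 ((p + m) + (q + n))"
      unfolding mpochhammer_add[symmetric] by (simp add: add_ac)
    finally show ?thesis by (simp add: eq coef_def matrix_mul_assoc)
  qed
  have "?h (ext_F2 A B A' B' (A1 + mat (of_nat (m + n))) (B1 + mat (of_nat m)) (B2 + mat (of_nat n))
                 (C1 + mat (of_nat m)) (C2 + mat (of_nat n)) z w Y)
      = double_series (\<lambda>p q. coef A1 0 0 (p + m) (q + n)) z w"
    unfolding F2 double_series_linear[of ?h, OF h_linear h_mat bounded domain] coef_eq ..
  then show ?thesis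
    using double_series_has_mixed_derivative[OF bounded[of A1 0 0] domain, of m n]
    unfolding F20 pB1_def pB2_def iC1_def iC2_def by simp
qed

end
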